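(* Let $n\ge 3$ and let $H$ be any $n$-cyclic bigraph. Let $\vec p=(p_1,\dots,p_n)\in(0,1)^n$, with indices of $p$ taken cyclically modulo $n$ in $\{1,\dots,n\}$. For each $i\in[n]$, let $\lambda_i$ be the minimum positive $\lambda$ for which the system $b_1=\lambda p_i$, $b_k=\dfrac{\lambda p_{k+i-1}}{1-b_{k-1}}$ for $2\le k\le n-1$, $b_{n-1}=1-\lambda p_{i-1}$ has a solution $(b_1,\dots,b_{n-1})$. Let $\lambda_0=\min_{i\in[n]}\lambda_i$. Then $\lambda_0\vec p\in\partial(H)$.
   Context: A bigraph $H=([n],[m],E)$ has left part $[n]$, right part $[m]$, edge set $E\subseteq[n]\times[m]$, neighborhoods $\mathcal N_H(\cdot)$. Its base graph $G_H$ is the graph on $[n]$ where distinct $u,v$ are adjacent iff they share a neighbor in $H$. $H$ is $n$-cyclic if $G_H$ is a cycle of length $n$; when $n=3$ one additionally requires $\bigcap_{i\in[n]}\mathcal N_H(i)=\emptyset$. Equip $[0,1]^m$ with Lebesgue measure $\mu$. A family $\mathcal A=\{A_1,\dots,A_n\}$ of measurable subsets of $[0,1]^m$ conforms with $H$ ($\mathcal A\sim H$) if each $A_i=B_i\times[0,1]^{[m]\setminus\mathcal N_H(i)}$ with $B_i\subseteq[0,1]^{\mathcal N_H(i)}$ measurable. The interior $\mathcal I(H)$ is the set of $\vec p\in(0,1)^n$ with $\mu(\bigcap_i([0,1]^m\setminus A_i))>0$ for all $\mathcal A\sim H$ with $(\mu(A_i))_i=\vec p$; the boundary $\partial(H)$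 is the set of $\vec p\in(0,1]^n$ such that $(1-\epsilon)\vec p\in\mathcal I(H)$ and $(1+\epsilon)\vec p\notin\mathcal I(H)$ for all $\epsilon\in(0,1)$. *)

theory Defs
  imports "HOL-Analysis.Analysis"
begin

text \<open>
  A bigraph with left part \<open>{1..n}\<close> and right part \<open>{1..m}\<close> is given by \<open>n\<close>, \<open>m\<close> and its edge
  set \<open>E\<close>. Vectors indexed by \<open>{1..n}\<close> are functions on \<open>nat\<close> whose values outside \<open>{1..n}\<close> are
  never inspected.
\<close>

definition bigraph :: "nat \<Rightarrow> nat \<Rightarrow> (nat \<times> nat) set \<Rightarrow> bool" where
  "bigraph n m E \<longleftrightarrow> E \<subseteq> {1..n} \<times> {1..m}"

definition nbrs :: "(nat \<times> nat) set \<Rightarrow> nat \<Rightarrow> nat set" where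
  "nbrs E i = {j. (i, j) \<in> E}"

definition base_edges :: "nat \<Rightarrow> (nat \<times> nat) set \<Rightarrow> nat set set" where
  "base_edges n E =
     {{u, v} | u v. u \<in> {1..n} \<and> v \<in> {1..n} \<and> u \<noteq> v \<and> nbrs E u \<inter> nbrs E v \<noteq> {}}"

text \<open>The representative of \<open>k\<close> modulo \<open>n\<close> in \<open>{1..n}\<close>; in particular \<open>cyc n 0 = n\<close>.\<close>

definition cyc :: "nat \<Rightarrow> nat \<Rightarrow> nat" where
  "cyc n k = (k + n - 1) mod n + 1"

text \<open>For \<open>n \<ge> 3\<close>: the base graph is the cycle \<open>\<sigma> 1, \<sigma> 2, \<dots>, \<sigma> n, \<sigma> 1\<close>.\<close>

definition cycle_enumeration :: "nat \<Rightarrow> (nat \<times> nat) set \<Rightarrow> (nat \<Rightarrow> nat) \<Rightarrow> bool" where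
  "cycle_enumeration n E \<sigma> \<longleftrightarrow>
     bij_betw \<sigma> {1..n} {1..n} \<and>
     base_edges n E = (\<lambda>k. {\<sigma> k, \<sigma> (cyc n (k + 1))}) ` {1..n}"

definition n_cyclic :: "nat \<Rightarrow> (nat \<times> nat) set \<Rightarrow> bool" where
  "n_cyclic n E \<longleftrightarrow>
     (\<exists>\<sigma>. cycle_enumeration n E \<sigma>) \<and> (n = 3 \<longrightarrow> (\<Inter>i\<in>{1..n}. nbrs E i) = {})"

text \<open>
  The cube over a finite index set \<open>I\<close> with Lebesgue measure; the completion turns the Borel
  sets of the product measure into the Lebesgue measurable sets.
\<close>

definition cube :: "nat set \<Rightarrow> (nat \<Rightarrow> real) measure" where
  "cube I = completion (PiM I (\<lambda>_. restrict_space lborel {0..1}))"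

definition conforms :: "nat \<Rightarrow> nat \<Rightarrow> (nat \<times> nat) set \<Rightarrow> (nat \<Rightarrow> (nat \<Rightarrow> real) set) \<Rightarrow> bool" where
  "conforms n m E A \<longleftrightarrow>
     (\<forall>i\<in>{1..n}. A i \<in> sets (cube {1..m}) \<and>
        (\<exists>B \<in> sets (cube (nbrs E i)).
           A i = prod_emb {1..m} (\<lambda>_. restrict_space lborel {0..1}) (nbrs E i) B))"

definition lll_interior :: "nat \<Rightarrow> nat \<Rightarrow> (nat \<times> nat) set \<Rightarrow> (nat \<Rightarrow> real) set" where
  "lll_interior n m E =
     {p. (\<forall>i\<in>{1..n}. 0 < p i \<and> p i < 1) \<and>
         (\<forall>A. conforms n m E A \<and> (\<forall>i\<in>{1..n}. measure (cube {1..m}) (A i) = p i) \<longrightarrow>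
              measure (cube {1..m}) (\<Inter>i\<in>{1..n}. space (cube {1..m}) - A i) > 0)}"

definition lll_boundary :: "nat \<Rightarrow> nat \<Rightarrow> (nat \<times> nat) set \<Rightarrow> (nat \<Rightarrow> real) set" where
  "lll_boundary n m E =
     {p. (\<forall>i\<in>{1..n}. 0 < p i \<and> p i \<le> 1) \<and>
         (\<forall>\<epsilon>\<in>{0<..<1}. (\<lambda>i. (1 - \<epsilon>) * p i) \<in> lll_interior n m E \<and>
                        (\<lambda>i. (1 + \<epsilon>) * p i) \<notin> lll_interior n m E)}"

text \<open>
  \<open>b 1, \<dots>, b (n - 1)\<close> solve the system started at \<open>i\<close>. The condition \<open>b (k - 1) \<noteq> 1\<close> says that
  the quotient is defined; it is needed because \<open>x / 0 = 0\<close> in HOL.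
\<close>

definition solves_system ::
  "nat \<Rightarrow> (nat \<Rightarrow> real) \<Rightarrow> nat \<Rightarrow> real \<Rightarrow> (nat \<Rightarrow> real) \<Rightarrow> bool" where
  "solves_system n q i l b \<longleftrightarrow>
     b 1 = l * q i \<and>
     (\<forall>k\<in>{2..n - 1}. b (k - 1) \<noteq> 1 \<and> b k = l * q (cyc n (k + i - 1)) / (1 - b (k - 1))) \<and>
     b (n - 1) = 1 - l * q (cyc n (i - 1))"

definition is_min_scale :: "nat \<Rightarrow> (nat \<Rightarrow> real) \<Rightarrow> nat \<Rightarrow> real \<Rightarrow> bool" where
  "is_min_scale n q i l \<longleftrightarrow>
     l > 0 \<and> (\<exists>b. solves_system n q i l b) \<and>
     (\<forall>l' > 0. (\<exists>b. solves_system n q i l' b) \<longrightarrow> l \<le> l')"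

end

theory Submission
  imports Defs "HOL-Probability.Probability"
begin

text \<open>
  Group the variables by the pairs of consecutive events that they affect: the event \<open>A k\<close> then
  depends on two independent group variables \<open>x k\<close> and \<open>x (k + 1)\<close>, indices modulo \<open>n\<close>.

  Lower bound: suppose the events cover the cube. By Caratheodory's theorem in the plane, each group
  variable can be replaced by a two-valued one without destroying the cover or increasing a
  probability. In a boolean cover some event contains a whole row, \<open>x k = a\<close> say, or the two events
  around a variable are both of the form \<open>x k \<noteq> x (k + 1)\<close> up to renaming values. In either case the
  slice at one value of \<open>x k\<close> is a cover by a path of events. For a path the recursion
  \<open>b k = p k / (1 - b (k - 1))\<close> bounds the probability of the values already covered, and it is
  convex; hence the slice is compared with the two paths obtained from the cycle by cutting on either
  side of an event, and one of these must already be critical.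

  Upper bound: at the critical scale of the path starting at \<open>i\<close>, the rectangles
  \<open>{x (k - 1) \<ge> b (k - 1)} \<inter> {x k \<le> b k}\<close> have the prescribed probabilities and cover the cube.
\<close>

section \<open>The path recursion\<close>

text \<open>The obstacle is that a cycle has no end at which a recursion could start. Fixing a
  variable opens the cycle but distorts the two events beside the cut. If one of them, of
  probability \<open>p\<close>, contains everything off the slice, a part of weight
  \<open>t\<close>, then its conditional probability is at most \<open>(p - t) / (1 - t)\<close>,
  while that of the other, of probability \<open>p'\<close>, may rise to
  \<open>p' / (1 - t)\<close>. Both bounds are affine in \<open>1 / (1 - t)\<close>, and the
  extremes \<open>t = 0\<close> and \<open>t = p\<close> correspond exactly to the two cuts beside
  the first event. This is why convexity of the recursion controls every \<open>t\<close> in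
  between. A pair of exclusive-or events is brought to the same form by a fictitious
  \<open>t\<close>. The boolean argument needs a cover without exceptions, whereas the hypothesis
  only gives one up to a null set; therefore both values of each two-valued variable must keep
  positive mass.\<close>

primrec chain :: "(nat \<Rightarrow> real) \<Rightarrow> nat \<Rightarrow> nat \<Rightarrow> real" where
  "chain p i 0 = p i"
| "chain p i (Suc j) = p (i + Suc j) / (1 - chain p i j)"

text \<open>The range reaches one step beyond the unknowns of the system. Since
  \<open>chain p i (n - 2)\<close> plays the role of \<open>b (n - 1)\<close>, the step with index
  \<open>n - 1\<close> turns the closing equation into the strict inequality
  \<open>p (i + (n - 1)) < 1 - b (n - 1)\<close>.\<close>

definition subcritical :: "nat \<Rightarrow> (nat \<Rightarrow> real) \<Rightarrow> nat \<Rightarrow> bool" where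
  "subcritical n p i \<longleftrightarrow> (\<forall>j<n. chain p i j < 1)"

text \<open>One step of the recursion, sending \<open>y\<close> to \<open>q / (1 - y)\<close>, is
  increasing and convex below 1.\<close>

lemma divide_one_minus_convex:
  fixes b c th q y :: real
  assumes "0 \<le> th" "th \<le> 1" "b < 1" "c < 1" "0 \<le> q" and y: "y \<le> th * b + (1 - th) * c"
  shows "y < 1" "q / (1 - y) \<le> th * (q / (1 - b)) + (1 - th) * (q / (1 - c))"
proof -
  define X where "X = th * (1 - b) + (1 - th) * (1 - c)"
  have X: "X > 0"
  proof (cases "th = 0")
    case False
    then have "th * (1 - b) > 0" "(1 - th) * (1 - c) \<ge> 0" using assms by auto
    then show ?thesis by (simp add: X_def)
  qed (use assms in \<open>simp add: X_def\<close>)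
  have XY: "X \<le> 1 - y" using y by (simp add: X_def algebra_simps)
  with X show "y < 1" by linarith
  have "convex_on {0<..} (inverse :: real \<Rightarrow> real)"
    by (rule convex_on_inverse) auto
  from convex_onD[OF this, of "1 - th" "1 - b" "1 - c"]
  have "inverse X \<le> th * inverse (1 - b) + (1 - th) * inverse (1 - c)"
    using assms by (simp add: X_def)
  then have "q * inverse X \<le> q * (th * inverse (1 - b) + (1 - th) * inverse (1 - c))"
    using \<open>0 \<le> q\<close> by (rule mult_left_mono)
  moreover have "q / (1 - y) \<le> q / X"
    using XY X \<open>0 \<le> q\<close> by (intro divide_left_mono) auto
  ultimately show "q / (1 - y) \<le> th * (q / (1 - b)) + (1 - th) * (q / (1 - c))"
    by (simp add: divide_inverse algebra_simps)
qed

lemma convex_comb_less: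
  fixes th a b c d :: real
  assumes "0 \<le> th" "th \<le> 1" "a < c" "b < d"
  shows "th * a + (1 - th) * b < th * c + (1 - th) * d"
proof (cases "th = 0")
  case False
  then have "th * a < th * c" "(1 - th) * b \<le> (1 - th) * d"
    using assms by (auto intro: mult_left_mono)
  then show ?thesis by linarith
qed (use assms in simp)

text \<open>\<open>b\<close> and \<open>c\<close> are exact orbits, \<open>y\<close> only satisfies
  the recursion as an inequality. Monotonicity and convexity of a step propagate the initial bound;
  \<open>b k < 1\<close> and \<open>c k < 1\<close> force \<open>y k < 1\<close>, which permits the
  division.\<close>

lemma chain_interpolation:
  fixes y b c q :: "nat \<Rightarrow> real"
  assumes th: "0 \<le> th" "th \<le> 1"
    and q: "\<And>k. k < N \<Longrightarrow> 0 \<le> q k"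
    and y: "\<And>k. k < N \<Longrightarrow> (1 - y k) * y (Suc k) \<le> q k"
    and b: "\<And>k. k < N \<Longrightarrow> b k < 1 \<and> b (Suc k) = q k / (1 - b k)"
    and c: "\<And>k. k < N \<Longrightarrow> c k < 1 \<and> c (Suc k) = q k / (1 - c k)"
    and y0: "y 0 \<le> th * b 0 + (1 - th) * c 0"
    and k: "k \<le> N"
  shows "y k \<le> th * b k + (1 - th) * c k"
  using k
proof (induction k)
  case 0
  show ?case by (fact y0)
next
  case (Suc k)
  then have k: "k < N" and IH: "y k \<le> th * b k + (1 - th) * c k" by auto
  note conv = divide_one_minus_convex[OF th conjunct1[OF b[OF k]] conjunct1[OF c[OF k]] q[OF k] IH]
  have "y (Suc k) \<le> q k / (1 - y k)"
    using y[OF k] conv(1) by (simp add: pos_le_divide_eq mult.commute)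
  also have "\<dots> \<le> th * b (Suc k) + (1 - th) * c (Suc k)"
    using conv(2) b[OF k] c[OF k] by simp
  finally show ?case .
qed

lemma subcritical_last:
  assumes "2 \<le> n" "subcritical n p i"
  shows "p (i + (n - 1)) < 1 - chain p i (n - 2)"
proof -
  obtain N where n: "n = Suc (Suc N)" using assms(1) by (metis add_2_eq_Suc le_Suc_ex)
  have "chain p i N < 1" "chain p i (Suc N) < 1"
    using assms(2) unfolding subcritical_def n by (blast intro: lessI less_SucI)+
  then show ?thesis by (simp add: n pos_divide_less_eq)
qed

text \<open>The slice has weight \<open>1 - t\<close>, \<open>y 0\<close> and \<open>g\<close> are
  the conditional probabilities of events \<open>0\<close> and \<open>n - 1\<close> in it, and event
  \<open>0\<close> contains everything off the slice. At \<open>t = 0\<close> the slice is the path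
  starting at event \<open>0\<close>. At \<open>t = p 0\<close> event \<open>0\<close> disappears
  from the slice and event \<open>n - 1\<close> grows to \<open>p (n - 1) / (1 - p 0)\<close>; this
  is critical exactly when the path starting at event \<open>1\<close> is.\<close>

lemma slice_contradiction_forward:
  fixes p y :: "nat \<Rightarrow> real"
  assumes n: "3 \<le> n" and per: "\<And>k. p (k + n) = p k" and pos: "\<And>k. 0 < p k"
    and sub: "\<And>i. subcritical n p i"
    and y: "\<And>k. k < n - 2 \<Longrightarrow> (1 - y k) * y (Suc k) \<le> p (Suc k)"
    and last: "1 - g \<le> y (n - 2)" and nn: "0 \<le> y 0"
    and t: "0 \<le> t" "t < 1" "t + (1 - t) * y 0 \<le> p 0" "(1 - t) * g \<le> p (n - 1)"
  shows False
proof -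
  have p1: "p i < 1" for i
    using sub[of i] n by (auto simp: subcritical_def dest: spec[of _ 0])
  define u where "u = 1 / (1 - t)"
  have u1: "u \<ge> 1" using t by (simp add: u_def)
  have tp: "t \<le> p 0" using t nn by (smt (verit) mult_nonneg_nonneg)
  have up: "u * (1 - p 0) \<le> 1" using tp t by (simp add: u_def divide_simps)
  \<comment> \<open>Chosen so that the largest possible \<open>y 0\<close>, which is
    \<open>(p 0 - t) / (1 - t) = 1 - (1 - p 0) * u\<close>, equals
    \<open>th * p 0 + (1 - th) * 0\<close>.\<close>
  define th where "th = (1 - (1 - p 0) * u) / p 0"
  have th: "0 \<le> th" "th \<le> 1"
  proof -
    have "1 - p 0 \<le> (1 - p 0) * u" using u1 p1[of 0] by (simp add: mult_le_cancel_left1)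
    then show "th \<le> 1" using pos[of 0] by (simp add: th_def pos_divide_le_eq)
    show "0 \<le> th" using up pos[of 0] by (simp add: th_def mult.commute)
  qed
  have thp: "th * p 0 = 1 - (1 - p 0) * u" using pos[of 0] by (simp add: th_def)
  define b where "b = chain p 0"
  define c where "c = (\<lambda>k. case k of 0 \<Rightarrow> 0 | Suc k \<Rightarrow> chain p 1 k)"
  have "y (n - 2) \<le> th * b (n - 2) + (1 - th) * c (n - 2)"
  proof (rule chain_interpolation[OF th, where q = "\<lambda>k. p (Suc k)" and N = "n - 2"])
    show "0 \<le> p (Suc k)" for k using pos less_imp_le by blast
    show "b k < 1 \<and> b (Suc k) = p (Suc k) / (1 - b k)" if "k < n - 2" for k
      using sub[of 0] that by (auto simp: b_def subcritical_def)
    show "c k < 1 \<and> c (Suc k) = p (Suc k) / (1 - c k)" if "k < n - 2" for k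
      using sub[of 1] that by (cases k) (auto simp: c_def subcritical_def)
    have "(1 - t) * y 0 \<le> p 0 - t" using t by simp
    then have "y 0 \<le> (p 0 - t) / (1 - t)" using t by (simp add: pos_le_divide_eq mult.commute)
    also have "\<dots> = 1 - (1 - p 0) * u" using t by (simp add: u_def divide_simps)
    finally show "y 0 \<le> th * b 0 + (1 - th) * c 0" by (simp add: thp b_def c_def)
  qed (use y in auto)
  moreover have "b (n - 2) < 1 - p (n - 1)"
    using subcritical_last[OF _ sub[of 0]] n by (simp add: b_def)
  \<comment> \<open>The path from event \<open>1\<close> ends with event \<open>0\<close>; solving
    its last two steps for \<open>p (n - 1)\<close> moves the factor \<open>1 - p 0\<close> to the
    other side.\<close>
  moreover have "c (n - 2) < 1 - p (n - 1) / (1 - p 0)"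
  proof -
    obtain N where N: "n = Suc (Suc (Suc N))"
      using n by (metis Suc_le_D numeral_3_eq_3 Suc_le_mono)
    have "p (1 + (n - 1)) = p 0" using per[of 0] n by simp
    then have "p 0 < 1 - chain p 1 (n - 2)"
      using subcritical_last[OF _ sub[of 1]] n by simp
    then have "p (n - 1) / (1 - chain p 1 N) < 1 - p 0" by (simp add: N)
    moreover have "chain p 1 N < 1" using sub[of 1] by (simp add: subcritical_def N)
    ultimately have "p (n - 1) < (1 - p 0) * (1 - chain p 1 N)" by (simp add: pos_divide_less_eq)
    then have "p (n - 1) / (1 - p 0) < 1 - chain p 1 N"
      using p1[of 0] by (simp add: pos_divide_less_eq mult.commute)
    then show ?thesis by (simp add: c_def N)
  qed
  ultimately have "y (n - 2) < th * (1 - p (n - 1)) + (1 - th) * (1 - p (n - 1) / (1 - p 0))"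
    using convex_comb_less[OF th] by (meson le_less_trans)
  also have "\<dots> = 1 - p (n - 1) * (th + (1 - th) / (1 - p 0))"
    by (simp add: algebra_simps)
  \<comment> \<open>The growth factor \<open>u\<close> interpolates between \<open>1\<close> and
    \<open>1 / (1 - p 0)\<close> with the same \<open>th\<close>, so nothing is lost here.\<close>
  also have "th + (1 - th) / (1 - p 0) = u"
  proof -
    have "th * (1 - p 0) + (1 - th) = u * (1 - p 0)" using thp by (simp add: algebra_simps)
    then show ?thesis using p1[of 0] by (simp add: divide_simps)
  qed
  finally have "y (n - 2) < 1 - p (n - 1) * u" .
  moreover have "g \<le> p (n - 1) * u" using t by (simp add: u_def pos_le_divide_eq mult.commute)
  ultimately show False using last by linarith
qed

text \<open>Mirror situation: event \<open>n - 1\<close> contains everything off the slice, yet the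
  recursion still runs upwards from event \<open>0\<close>. The second extreme is
  \<open>t = p (n - 1)\<close>, where \<open>g = 0\<close> and \<open>y 0\<close> may reach
  \<open>p 0 / (1 - p (n - 1))\<close>, the second term of the path starting at event
  \<open>n - 1\<close>.\<close>

lemma slice_contradiction_backward:
  fixes p y :: "nat \<Rightarrow> real"
  assumes n: "3 \<le> n" and per: "\<And>k. p (k + n) = p k" and pos: "\<And>k. 0 < p k"
    and sub: "\<And>i. subcritical n p i"
    and y: "\<And>k. k < n - 2 \<Longrightarrow> (1 - y k) * y (Suc k) \<le> p (Suc k)"
    and last: "1 - g \<le> y (n - 2)" and nn: "0 \<le> g"
    and t: "0 \<le> t" "t < 1" "t + (1 - t) * g \<le> p (n - 1)" "(1 - t) * y 0 \<le> p 0"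
  shows False
proof -
  define r where "r = p (n - 1)"
  have p1: "p i < 1" for i
    using sub[of i] n by (auto simp: subcritical_def dest: spec[of _ 0])
  have r: "0 < r" "r < 1" using pos p1 by (auto simp: r_def)
  define u where "u = 1 / (1 - t)"
  have u1: "u \<ge> 1" using t by (simp add: u_def)
  have tp: "t \<le> r" using t nn unfolding r_def by (smt (verit) mult_nonneg_nonneg)
  have up: "u * (1 - r) \<le> 1" using tp t by (simp add: u_def divide_simps)
  define th where "th = (1 - (1 - r) * u) / r"
  have th: "0 \<le> th" "th \<le> 1"
  proof -
    have "1 - r \<le> (1 - r) * u" using u1 r by (simp add: mult_le_cancel_left1)
    then have "1 - (1 - r) * u \<le> r" by linarith
    then show "th \<le> 1" using r by (simp add: th_def pos_divide_le_eq)
    show "0 \<le> th" using up r by (simp add: th_def mult.commute)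
  qed
  have thp: "th * r = 1 - (1 - r) * u" using r by (simp add: th_def)
  have u: "u = th + (1 - th) / (1 - r)"
  proof -
    have "th * (1 - r) + (1 - th) = u * (1 - r)" using thp by (simp add: algebra_simps)
    then show ?thesis using r by (simp add: divide_simps)
  qed
  define b where "b = chain p 0"
  \<comment> \<open>Shifted by one: \<open>c 0\<close> is that second term, and
    \<open>c (n - 2)\<close> is the last term, of index \<open>n - 1\<close>, in the same
    path.\<close>
  define c where "c = (\<lambda>k. chain p (n - 1) (Suc k))"
  have shift: "p (n - 1 + Suc k) = p k" for k using per[of k] n by (simp add: add.commute)
  have step: "chain p (n - 1) (Suc k) = p k / (1 - chain p (n - 1) k)" for k
    using shift[of k] by (simp only: chain.simps)
  have "y (n - 2) \<le> th * b (n - 2) + (1 - th) * c (n - 2)"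
  proof (rule chain_interpolation[OF th, where q = "\<lambda>k. p (Suc k)" and N = "n - 2"])
    show "0 \<le> p (Suc k)" for k using pos less_imp_le by blast
    show "b k < 1 \<and> b (Suc k) = p (Suc k) / (1 - b k)" if "k < n - 2" for k
      using sub[of 0] that by (auto simp: b_def subcritical_def)
    show "c k < 1 \<and> c (Suc k) = p (Suc k) / (1 - c k)" if "k < n - 2" for k
      unfolding c_def using sub[of "n - 1"] that
      by (intro conjI step) (auto simp: subcritical_def simp del: chain.simps)
    have "y 0 \<le> p 0 * u" using t by (simp add: u_def pos_le_divide_eq mult.commute)
    also have "\<dots> = th * b 0 + (1 - th) * c 0"
      unfolding c_def step by (simp add: u b_def r_def algebra_simps)
    finally show "y 0 \<le> th * b 0 + (1 - th) * c 0" .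
  qed (use y in auto)
  moreover have "b (n - 2) < 1 - r"
    using subcritical_last[OF _ sub[of 0]] n by (simp add: b_def r_def)
  moreover have "c (n - 2) < 1"
    using sub[of "n - 1"] n by (simp only: c_def subcritical_def)
  ultimately have "y (n - 2) < th * (1 - r) + (1 - th) * 1"
    using convex_comb_less[OF th] by (meson le_less_trans)
  also have "\<dots> = (1 - r) * u" using thp by (simp add: algebra_simps)
  finally have "y (n - 2) < (1 - r) * u" .
  moreover have "g \<le> (r - t) / (1 - t)" using t by (simp add: r_def pos_le_divide_eq algebra_simps)
  moreover have "(r - t) / (1 - t) = 1 - (1 - r) * u" using t by (simp add: u_def divide_simps)
  ultimately show False using last by linarith
qed

section \<open>Boolean covers of a cycle\<close>

definition wt :: "(bool \<Rightarrow> real) \<Rightarrow> (bool \<Rightarrow> bool) \<Rightarrow> real" where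
  "wt w S = w True * of_bool (S True) + w False * of_bool (S False)"

definition wt2 :: "(bool \<Rightarrow> real) \<Rightarrow> (bool \<Rightarrow> real) \<Rightarrow> (bool \<Rightarrow> bool \<Rightarrow> bool) \<Rightarrow> real" where
  "wt2 v w R = v True * wt w (R True) + v False * wt w (R False)"

lemma wt_nonneg: "(\<And>b. 0 \<le> w b) \<Longrightarrow> 0 \<le> wt w S"
  by (simp add: wt_def)

lemma wt_compl: "w True + w False = 1 \<Longrightarrow> wt w (\<lambda>b. \<not> S b) = 1 - wt w S"
  by (cases "S True"; cases "S False") (simp_all add: wt_def)

lemma wt_mono:
  assumes "\<And>b. 0 \<le> w b" "\<And>b. S b \<Longrightarrow> T b"
  shows "wt w S \<le> wt w T"
  unfolding wt_def using assms by (intro add_mono mult_left_mono) auto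

lemma wt_UNIV: "w True + w False = 1 \<Longrightarrow> (\<And>b. S b) \<Longrightarrow> wt w S = 1"
  by (simp add: wt_def)

lemma wt_disj_le:
  assumes "\<And>b. 0 \<le> w b"
  shows "wt w (\<lambda>b. S b \<or> T b) \<le> wt w S + wt w T"
  using assms[of True] assms[of False]
  by (cases "S True"; cases "S False"; cases "T True"; cases "T False") (simp_all add: wt_def)

lemma wt2_rows: "wt2 v w R = v a * wt w (R a) + v (\<not> a) * wt w (R (\<not> a))"
  by (cases a) (simp_all add: wt2_def)

lemma wt2_cols: "wt2 v w R = w b * wt v (\<lambda>a. R a b) + w (\<not> b) * wt v (\<lambda>a. R a (\<not> b))"
  by (cases b) (simp_all add: wt_def wt2_def algebra_simps)

lemma wt2_mono:
  assumes "\<And>b. 0 \<le> v b" "\<And>b. 0 \<le> w b" "\<And>a b. R a b \<Longrightarrow> S a b"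
  shows "wt2 v w R \<le> wt2 v w S"
  unfolding wt2_def using assms by (intro add_mono mult_left_mono wt_mono) auto

lemma wt2_times: "wt2 v w (\<lambda>a b. S a \<and> T b) = wt v S * wt w T"
  by (cases "S True"; cases "S False") (simp_all add: wt_def wt2_def algebra_simps)

lemma periodic_mod:
  assumes "\<And>k. f (k + n) = f (k::nat)"
  shows "f k = f (k mod n)"
proof -
  have "f (k mod n + n * j) = f (k mod n)" for j
  proof (induction j)
    case (Suc j)
    then show ?case using assms[of "k mod n + n * j"] by (simp add: ac_simps)
  qed simp
  from this[of "k div n"] show ?thesis by simp
qed

text \<open>\<open>blocked F Q k y\<close>: every assignment to the earlier variables that ends in the value \<open>y\<close>
  of the variable \<open>k + 1\<close> meets one of the events.\<close>

primrec blocked :: "(bool \<Rightarrow> bool) \<Rightarrow> (nat \<Rightarrow> bool \<Rightarrow> bool \<Rightarrow> bool) \<Rightarrow> nat \<Rightarrow> bool \<Rightarrow> bool" where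
  "blocked F Q 0 = F"
| "blocked F Q (Suc k) = (\<lambda>y. \<forall>x. \<not> blocked F Q k x \<longrightarrow> Q (Suc k) x y)"

lemma not_blocked:
  "\<not> blocked F Q k y \<Longrightarrow> \<exists>x. x (Suc k) = y \<and> \<not> F (x 1) \<and> (\<forall>i\<in>{1..k}. \<not> Q i (x i) (x (Suc i)))"
proof (induction k arbitrary: y)
  case 0
  then show ?case by (auto intro: exI[of _ "\<lambda>_. y"])
next
  case (Suc k)
  then obtain z where z: "\<not> blocked F Q k z" "\<not> Q (Suc k) z y" by auto
  from Suc.IH[OF z(1)] obtain x where
    x: "x (Suc k) = z" "\<not> F (x 1)" "\<forall>i\<in>{1..k}. \<not> Q i (x i) (x (Suc i))" by blast
  show ?case
    by (rule exI[of _ "x(Suc (Suc k) := y)"]) (use x z in \<open>auto simp: le_Suc_eq\<close>)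
qed

text \<open>An unblocked \<open>x\<close> followed by a blocked \<open>y\<close> must meet event
  \<open>Suc k\<close>. Such pairs form a product set inside that event, whose weight factorizes;
  this is the recursion as an inequality.\<close>

lemma blocked_weight:
  assumes w: "\<And>k b. 0 \<le> w k b" "\<And>k. w k True + w k False = (1::real)"
    and p: "wt2 (w (Suc k)) (w (Suc (Suc k))) (Q (Suc k)) \<le> p (Suc k)"
  shows "(1 - wt (w (Suc k)) (blocked F Q k)) * wt (w (Suc (Suc k))) (blocked F Q (Suc k)) \<le> p (Suc k)"
proof -
  have "(1 - wt (w (Suc k)) (blocked F Q k)) * wt (w (Suc (Suc k))) (blocked F Q (Suc k))
      = wt2 (w (Suc k)) (w (Suc (Suc k))) (\<lambda>x y. \<not> blocked F Q k x \<and> blocked F Q (Suc k) y)"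
    by (simp add: wt2_times wt_compl[OF w(2)])
  also have "\<dots> \<le> wt2 (w (Suc k)) (w (Suc (Suc k))) (Q (Suc k))"
    using w(1) by (intro wt2_mono) auto
  finally show ?thesis using p by linarith
qed

text \<open>With \<open>x 0 = a\<close> fixed, event \<open>0\<close> becomes the set of values of
  \<open>x 1\<close> covered from the start, and event \<open>n - 1\<close> becomes a column because
  \<open>x n = x 0\<close>. Each value of \<open>x (n - 1)\<close> is blocked or lies in that
  column, so the union bound gives the last inequality.\<close>

lemma slice_chain:
  assumes n: "3 \<le> n"
    and w: "\<And>k b. 0 \<le> w k b" "\<And>k. w k True + w k False = (1::real)"
    and Q: "\<And>k. Q (k + n) = Q k"
    and p: "\<And>k. wt2 (w k) (w (Suc k)) (Q k) \<le> p k"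
    and cover: "\<And>x. (\<And>k. x (k + n) = x k) \<Longrightarrow> \<exists>k. Q k (x k) (x (Suc k))"
  shows "\<exists>y. y 0 = wt (w 1) (Q 0 a) \<and> (\<forall>k<n - 2. (1 - y k) * y (Suc k) \<le> p (Suc k)) \<and>
    1 - wt (w (n - 1)) (\<lambda>x. Q (n - 1) x a) \<le> y (n - 2)"
proof -
  let ?D = "blocked (Q 0 a) Q"
  let ?y = "\<lambda>k. wt (w (Suc k)) (?D k)"
  have step: "(1 - ?y k) * ?y (Suc k) \<le> p (Suc k)" for k
    by (rule blocked_weight) (use w p in auto)
  have full: "?D (n - 2) z \<or> Q (n - 1) z a" for z
  proof (rule ccontr)
    assume neg: "\<not> ?thesis"
    then obtain x where x: "x (n - 1) = z" "\<not> Q 0 a (x 1)"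
      "\<forall>i\<in>{1..n - 2}. \<not> Q i (x i) (x (Suc i))"
      using not_blocked[of "Q 0 a" Q "n - 2" z] n by (auto simp: Suc_diff_Suc numeral_2_eq_2)
    \<comment> \<open>The unblocked path assignment, closed up by the value \<open>a\<close> at
      position \<open>0\<close> and repeated periodically.\<close>
    define x' where "x' = (\<lambda>k. (x(0 := a)) (k mod n))"
    note Qmod = periodic_mod[of Q n, OF Q]
    have "\<exists>k. Q k (x' k) (x' (Suc k))" by (rule cover) (simp add: x'_def)
    then obtain k where k: "Q k (x' k) (x' (Suc k))" ..
    define r where "r = k mod n"
    have r: "r < n" using n by (simp add: r_def)
    have k': "Q r ((x(0 := a)) r) ((x(0 := a)) (Suc r mod n))"
      using k Qmod[of k] by (simp add: x'_def r_def mod_Suc_eq)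
    consider "r = 0" | "r \<in> {1..n - 2}" | "r = n - 1" using r by fastforce
    then show False
    proof cases
      case 1 then show False using k' x n by auto
    next
      case 2 then show False using k' x n by (auto simp: mod_less)
    next
      case 3 then show False using k' x n neg by auto
    qed
  qed
  have "1 = wt (w (n - 1)) (\<lambda>z. ?D (n - 2) z \<or> Q (n - 1) z a)"
    using full w(2)[of "n - 1"] by (intro wt_UNIV[symmetric]) auto
  also have "\<dots> \<le> wt (w (n - 1)) (?D (n - 2)) + wt (w (n - 1)) (\<lambda>z. Q (n - 1) z a)"
    using w(1) by (rule wt_disj_le)
  finally have "1 - wt (w (n - 1)) (\<lambda>x. Q (n - 1) x a) \<le> ?y (n - 2)"
    using n by (simp add: Suc_diff_Suc numeral_2_eq_2)
  with step show ?thesis by (intro exI[of _ ?y]) simp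
qed

text \<open>A 2 by 2 table without full row and without empty column has exactly one entry in every
  row and column; it is the graph of equality or of inequality.\<close>

lemma full_row_or_empty_col:
  fixes R :: "bool \<Rightarrow> bool \<Rightarrow> bool"
  shows "(\<exists>a. \<forall>b. R a b) \<or> (\<exists>b. \<forall>a. \<not> R a b) \<or>
     (\<exists>c. \<forall>a b. R a b \<longleftrightarrow> (a \<longleftrightarrow> b \<longleftrightarrow> c))"
  by (simp only: all_bool_eq ex_bool_eq) blast

text \<open>Without full rows one can start with \<open>x 1 = e\<close> and choose each further
  value so as to avoid the next event. The loop closes because event \<open>0\<close> misses
  \<open>e\<close> whatever \<open>x 0\<close> turns out to be.\<close>

lemma full_row_exists:
  assumes n: "3 \<le> n"
    and Q: "\<And>k. Q (k + n) = Q k"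
    and cover: "\<And>x. (\<And>k. x (k + n) = x k) \<Longrightarrow> \<exists>k. Q k (x k) (x (Suc k))"
    and e: "\<And>a. \<not> Q 0 a e"
  shows "\<exists>k a. \<forall>b. Q k a (b::bool)"
proof (rule ccontr)
  assume "\<not> ?thesis"
  then have "\<forall>k a. \<exists>b. \<not> Q k a b" by blast
  then obtain s where s: "\<And>k a. \<not> Q k a (s k a)" by metis
  \<comment> \<open>The entry at \<open>0\<close> is a placeholder; position \<open>0\<close> of the
    loop receives \<open>z n\<close>, the value reached last.\<close>
  define z where "z = rec_nat undefined (\<lambda>k y. if k = 0 then e else s k y)"
  have z: "z (Suc k) = (if k = 0 then e else s k (z k))" for k by (simp add: z_def)
  define x where "x = (\<lambda>k. if k mod n = 0 then z n else z (k mod n))"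
  note Qmod = periodic_mod[of Q n, OF Q]
  have "\<exists>k. Q k (x k) (x (Suc k))" by (rule cover) (simp add: x_def)
  then obtain k where k: "Q k (x k) (x (Suc k))" ..
  define r where "r = k mod n"
  have r: "r < n" using n by (simp add: r_def)
  have "Suc k mod n = Suc r mod n" by (simp add: r_def mod_Suc_eq)
  moreover have "x (Suc k) = z (Suc r)"
    using r calculation by (cases "Suc r = n") (auto simp: x_def)
  moreover have "x k = x r" by (simp add: x_def r_def)
  ultimately have "Q r (x r) (z (Suc r))" using k Qmod[of k] by (simp add: r_def)
  then show False using e s r by (auto simp: z x_def split: if_splits)
qed

lemma subcritical_shift: "subcritical n (\<lambda>k. p (k + j)) i = subcritical n p (i + j)"
proof -
  have "chain (\<lambda>k. p (k + j)) i k = chain p (i + j) k" for k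
    by (induction k) (simp_all add: ac_simps)
  then show ?thesis by (simp add: subcritical_def)
qed

text \<open>Slicing at the value opposite to the full row gives the forward comparison, with
  \<open>t\<close> the weight of the full row. For event \<open>n - 1\<close> the part off the slice
  is simply dropped.\<close>

lemma no_cover_full_row:
  assumes n: "3 \<le> n"
    and per: "\<And>k. p (k + n) = p k" and pos: "\<And>k. 0 < p k" and sub: "\<And>i. subcritical n p i"
    and w: "\<And>k b. 0 \<le> w k b" "\<And>k. w k True + w k False = (1::real)"
    and wper: "\<And>k. w (k + n) = w k"
    and Q: "\<And>k. Q (k + n) = Q k"
    and p: "\<And>k. wt2 (w k) (w (Suc k)) (Q k) \<le> p k"
    and cover: "\<And>x. (\<And>k. x (k + n) = x k) \<Longrightarrow> \<exists>k. Q k (x k) (x (Suc k))"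
    and row: "\<And>b. Q 0 (\<not> a) b"
  shows False
proof -
  define t where "t = w 0 (\<not> a)"
  have wa: "w 0 a = 1 - t" using w(2)[of 0] by (cases a) (auto simp: t_def)
  have wn: "w n = w 0" using wper[of 0] by simp
  have 1: "t + (1 - t) * wt (w 1) (Q 0 a) \<le> p 0"
    using p[of 0] wt_UNIV[OF w(2)[of 1], of "Q 0 (\<not> a)"] row
    by (simp add: wt2_rows[of _ _ _ a] t_def[symmetric] wa)
  have "0 \<le> t * wt (w (n - 1)) (\<lambda>x. Q (n - 1) x (\<not> a))"
    unfolding t_def by (intro mult_nonneg_nonneg wt_nonneg w)
  then have 2: "(1 - t) * wt (w (n - 1)) (\<lambda>x. Q (n - 1) x a) \<le> p (n - 1)"
    using p[of "n - 1"] n by (simp add: wt2_cols[of _ _ _ a] t_def[symmetric] wa wn)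
  have nn: "0 \<le> wt (w 1) (Q 0 a)" by (intro wt_nonneg w)
  have t0: "0 \<le> t" using w by (simp add: t_def)
  have "0 \<le> (1 - t) * wt (w 1) (Q 0 a)" using nn w(1)[of 0 a] by (simp add: wa)
  moreover have "p 0 < 1" using sub[of 0] n by (auto simp: subcritical_def dest: spec[of _ 0])
  ultimately have t1: "t < 1" using 1 by linarith
  from slice_chain[OF n w Q p cover, of a] obtain y where
    "y 0 = wt (w 1) (Q 0 a)" "\<forall>k<n - 2. (1 - y k) * y (Suc k) \<le> p (Suc k)"
    "1 - wt (w (n - 1)) (\<lambda>x. Q (n - 1) x a) \<le> y (n - 2)" by blast
  with slice_contradiction_forward[OF n per pos sub, of y _ t] 1 2 nn t0 t1
  show False by metis
qed

text \<open>An exclusive-or at \<open>x 0\<close> is replaced by a fictitious full-row event with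
  the same slice and the same probability. On the heavier value of \<open>x 0\<close> the two slices
  have total weight below 1, so one of them is at most 1/2; that one is replaced, which makes the
  fictitious weight nonnegative.\<close>

lemma no_cover_xor:
  assumes n: "3 \<le> n"
    and per: "\<And>k. p (k + n) = p k" and pos: "\<And>k. 0 < p k" and sub: "\<And>i. subcritical n p i"
    and w: "\<And>k b. 0 \<le> w k b" "\<And>k. w k True + w k False = (1::real)"
    and wper: "\<And>k. w (k + n) = w k"
    and Q: "\<And>k. Q (k + n) = Q k"
    and p: "\<And>k. wt2 (w k) (w (Suc k)) (Q k) \<le> p k"
    and cover: "\<And>x. (\<And>k. x (k + n) = x k) \<Longrightarrow> \<exists>k. Q k (x k) (x (Suc k))"
    and c: "\<And>a b. Q 0 a b \<longleftrightarrow> (a \<longleftrightarrow> b \<longleftrightarrow> c)" and d: "\<And>a b. Q (n - 1) a b \<longleftrightarrow> (a \<longleftrightarrow> b \<longleftrightarrow> d)"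
  shows False
proof -
  obtain a where a: "w 0 a \<ge> 1 / 2"
    using w(2)[of 0] by (metis field_sum_of_halves add_strict_mono not_le_imp_less order_less_irrefl)
  define s where "s = 1 - w 0 a"
  have wa: "w 0 a = 1 - s" "w 0 (\<not> a) = s" using w(2)[of 0] by (cases a; auto simp: s_def)+
  have s: "0 \<le> s" "s \<le> 1/2" using w(1)[of 0 "\<not> a"] a by (simp_all add: wa)
  have wn: "w n = w 0" using wper[of 0] by simp
  define \<alpha> where "\<alpha> = wt (w 1) (Q 0 a)"
  define \<beta> where "\<beta> = wt (w (n - 1)) (\<lambda>x. Q (n - 1) x a)"
  have wc: "wt (w k) (\<lambda>b. \<not> S b) = 1 - wt (w k) S" for k S
    by (rule wt_compl[OF w(2)])
  have "Q 0 (\<not> a) = (\<lambda>b. \<not> Q 0 a b)"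
    by (intro ext) (simp only: c, blast)
  then have 1: "(1 - s) * \<alpha> + s * (1 - \<alpha>) \<le> p 0"
    using p[of 0] by (simp add: wt2_rows[of _ _ _ a] wa wc \<alpha>_def)
  have "(\<lambda>x. Q (n - 1) x (\<not> a)) = (\<lambda>x. \<not> Q (n - 1) x a)"
    by (intro ext) (simp only: d, blast)
  then have 2: "(1 - s) * \<beta> + s * (1 - \<beta>) \<le> p (n - 1)"
    using p[of "n - 1"] n by (simp add: wt2_cols[of _ _ _ a] wa wn wc \<beta>_def)
  have nn: "0 \<le> \<alpha>" "0 \<le> \<beta>" unfolding \<alpha>_def \<beta>_def by (intro wt_nonneg w)+
  from slice_chain[OF n w Q p cover, of a] obtain y where
    y: "y 0 = \<alpha>" "\<forall>k<n - 2. (1 - y k) * y (Suc k) \<le> p (Suc k)"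
    "1 - \<beta> \<le> y (n - 2)" unfolding \<alpha>_def \<beta>_def by blast
  \<comment> \<open>Subcriticality of the path from event \<open>n - 1\<close>, read off after two
    steps.\<close>
  have "p (n - 1) + p 0 < 1"
  proof -
    have "chain p (n - 1) 0 < 1" "chain p (n - 1) (Suc 0) < 1"
      by (rule sub[unfolded subcritical_def, rule_format], use n in simp)+
    moreover have "p (n - 1 + Suc 0) = p 0" using per[of 0] n by simp
    ultimately show ?thesis by (simp add: pos_divide_less_eq)
  qed
  then have "s + s + (1 - 2 * s) * (\<alpha> + \<beta>) < 1" using 1 2 by (simp add: algebra_simps)
  then have "(1 - 2 * s) * (\<alpha> + \<beta>) < (1 - 2 * s) * 1" by simp
  then have ab: "\<alpha> + \<beta> < 1"
    using s mult_left_mono[of 1 "\<alpha> + \<beta>" "1 - 2 * s"] by linarith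
  have key: "\<exists>t\<ge>0. t < 1 \<and> t + (1 - t) * f = (1 - s) * f + s * (1 - f) \<and>
     (1 - t) * g \<le> (1 - s) * g + s * (1 - g)"
    if fg: "0 \<le> f" "0 \<le> g" "f + g < 1" "f \<le> 1 / 2" for f g
  proof -
    \<comment> \<open>The solution of \<open>t * (1 - f) = s * (1 - 2 * f)\<close>, which says that
      the full-row event has the probability of the exclusive-or. The other event stays within its
      probability because \<open>g \<le> 1 - f\<close>.\<close>
    define t where "t = s * (2 - 1 / (1 - f))"
    have f: "0 < 1 - f" using fg by linarith
    have "1 / (1 - f) \<le> 2" using fg by (simp add: pos_divide_le_eq)
    moreover have "1 / (1 - f) \<ge> 1" using fg by (simp add: pos_le_divide_eq)
    ultimately have t: "0 \<le> t" "t \<le> s" using s by (auto simp: t_def mult_le_cancel_left2)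
    have t1: "1 - t = (1 - 2 * s) + s / (1 - f)" by (simp add: t_def algebra_simps)
    have "(1 - t) * (1 - f) = (1 - 2 * s) * (1 - f) + s" using f unfolding t1 distrib_right by simp
    then have *: "t + (1 - t) * f = (1 - s) * f + s * (1 - f)" by (simp add: algebra_simps)
    have "g / (1 - f) \<le> 1" using fg f by (simp add: pos_divide_le_eq)
    then have "s * (g / (1 - f)) \<le> s" using s mult_left_mono[of "g / (1 - f)" 1 s] by simp
    then have "(1 - t) * g \<le> (1 - s) * g + s * (1 - g)" by (simp add: t1 algebra_simps)
    with t * s show ?thesis by (intro exI[of _ t]) auto
  qed
  show False
  proof (cases "\<alpha> \<le> 1 / 2")
    case True
    from key[of \<alpha> \<beta>] nn ab True obtain t where
      "0 \<le> t" "t < 1" "t + (1 - t) * \<alpha> = (1 - s) * \<alpha> + s * (1 - \<alpha>)"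
      "(1 - t) * \<beta> \<le> (1 - s) * \<beta> + s * (1 - \<beta>)" by blast
    with 1 2 slice_contradiction_forward[OF n per pos sub, of y \<beta> t] y nn show False by auto
  next
    case False
    from key[of \<beta> \<alpha>] nn ab False obtain t where
      "0 \<le> t" "t < 1" "t + (1 - t) * \<beta> = (1 - s) * \<beta> + s * (1 - \<beta>)"
      "(1 - t) * \<alpha> \<le> (1 - s) * \<alpha> + s * (1 - \<alpha>)" by auto
    with 1 2 slice_contradiction_backward[OF n per pos sub, of y \<beta> t] y nn show False by auto
  qed
qed

text \<open>Rotation moves any event to position \<open>0\<close>. A full row is impossible
  anywhere, and an empty column would produce one somewhere, so all tables are exclusive-ors up to
  renaming.\<close>

lemma no_cover_bool:
  assumes n: "3 \<le> n"
    and per: "\<And>k. p (k + n) = p k" and pos: "\<And>k. 0 < p k" and sub: "\<And>i. subcritical n p i"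
    and w: "\<And>k b. 0 \<le> w k b" "\<And>k. w k True + w k False = (1::real)"
    and wper: "\<And>k. w (k + n) = w k"
    and Q: "\<And>k. Q (k + n) = Q k"
    and p: "\<And>k. wt2 (w k) (w (Suc k)) (Q k) \<le> p k"
    and cover: "\<And>x. (\<And>k. x (k + n) = x k) \<Longrightarrow> \<exists>k. Q k (x k) (x (Suc k))"
  shows False
proof -
  have cover': "\<exists>k. Q (k + j) (x k) (x (Suc k))" if x: "\<And>k. x (k + n) = x k" for x j
  proof -
    \<comment> \<open>Rotating by \<open>r\<close> undoes a rotation by \<open>j\<close> without
      negative indices, as \<open>r + j\<close> is a multiple of \<open>n\<close>.\<close>
    define r where "r = n * Suc j - j"
    have r: "r + j = Suc j * n" using n by (simp add: r_def algebra_simps trans_le_add2)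
    have Qm: "Q (k + Suc j * n) = Q k" for k
      using periodic_mod[of Q n, OF Q] mod_mult_self1 by metis
    have "\<exists>k. Q k (x (k + r)) (x (Suc k + r))"
      using cover[of "\<lambda>k. x (k + r)"] x by (metis add.assoc add.commute)
    then obtain k where "Q k (x (k + r)) (x (Suc k + r))" ..
    moreover have "Q k = Q (k + r + j)" using Qm[of k] r by (simp add: add.assoc)
    ultimately show ?thesis by (intro exI[of _ "k + r"]) simp
  qed
  have no_row: False if "\<forall>b. Q k a b" for k a
  proof (rule no_cover_full_row[OF n, where p = "\<lambda>i. p (i + k)" and w = "\<lambda>i. w (i + k)"
        and Q = "\<lambda>i. Q (i + k)" and a = "\<not> a"])
    show "subcritical n (\<lambda>i. p (i + k)) i" for i by (simp add: subcritical_shift sub)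
    show "\<exists>i. Q (i + k) (x i) (x (Suc i))" if "\<And>i. x (i + n) = x i" for x
      by (rule cover') (rule that)
    show "p (i + n + k) = p (i + k)" "w (i + n + k) = w (i + k)" "Q (i + n + k) = Q (i + k)" for i
      using per[of "i + k"] wper[of "i + k"] Q[of "i + k"] by (simp_all add: ac_simps)
  qed (use that pos w p in auto)
  have no_col: False if "\<forall>a. \<not> Q k a e" for k e
  proof -
    have "\<exists>i a. \<forall>b. Q (i + k) a b"
    proof (rule full_row_exists[OF n, where Q = "\<lambda>i. Q (i + k)" and e = e])
      show "\<exists>i. Q (i + k) (x i) (x (Suc i))" if "\<And>i. x (i + n) = x i" for x
        by (rule cover') (rule that)
      show "Q (i + n + k) = Q (i + k)" for i using Q[of "i + k"] by (simp add: ac_simps)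
    qed (use that in auto)
    then show False using no_row by blast
  qed
  have "\<exists>c. \<forall>a b. Q k a b \<longleftrightarrow> (a \<longleftrightarrow> b \<longleftrightarrow> c)" for k
    using full_row_or_empty_col[of "Q k"] no_row[of k] no_col[of k] by blast
  note xor = this
  obtain c where c: "\<forall>a b. Q 0 a b \<longleftrightarrow> (a \<longleftrightarrow> b \<longleftrightarrow> c)" using xor[of 0] ..
  obtain d where d: "\<forall>a b. Q (n - 1) a b \<longleftrightarrow> (a \<longleftrightarrow> b \<longleftrightarrow> d)" using xor[of "n - 1"] ..
  show False
    by (rule no_cover_xor[OF n per pos sub w wper Q p cover, of c d]) (use c d in auto)
qed

section \<open>Two-point measures\<close>

lemma (in prob_space) ex_nonpos_of_expectation_nonpos:
  fixes f :: "'a \<Rightarrow> real"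
  assumes f: "integrable M f" "expectation f \<le> 0" and G: "AE x in M. G x"
  shows "\<exists>x\<in>space M. G x \<and> f x \<le> 0"
proof (rule ccontr)
  assume "\<not> ?thesis"
  then have pos: "AE x in M. 0 < f x" using G by (auto elim!: eventually_elim2[OF _ AE_space])
  have "integral\<^sup>L M (\<lambda>_. 0) < integral\<^sup>L M f"
    by (rule integral_less_AE_space) (use f pos in \<open>auto simp: emeasure_space_1\<close>)
  then show False using f by simp
qed

text \<open>Planar Caratheodory: a point below the mean is found on a segment between two values, because
  otherwise a line through the mean would support the distribution.\<close>

lemma (in prob_space) two_values_below_mean:
  fixes f g :: "'a \<Rightarrow> real"
  assumes f: "integrable M f" and g: "integrable M g" and G: "AE x in M. G x"
  shows "\<exists>u\<in>space M. \<exists>v\<in>space M. \<exists>s. G u \<and> G v \<and> 0 < s \<and> s < 1 \<and>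
    s * f u + (1 - s) * f v \<le> expectation f \<and> s * g u + (1 - s) * g v \<le> expectation g"
proof -
  define a where "a = (\<lambda>x. f x - expectation f)"
  define b where "b = (\<lambda>x. g x - expectation g)"
  have a: "integrable M a" "expectation a = 0" and b: "integrable M b" "expectation b = 0"
    using f g by (auto simp: a_def b_def prob_space)
  have "\<exists>u\<in>space M. \<exists>v\<in>space M. \<exists>s. G u \<and> G v \<and> 0 < s \<and> s < 1 \<and>
    s * a u + (1 - s) * a v \<le> 0 \<and> s * b u + (1 - s) * b v \<le> 0"
  proof (rule ccontr)
    assume neg: "\<not> ?thesis"
    have quad: "a x > 0 \<or> b x > 0" if "x \<in> space M" "G x" for x
    proof (rule ccontr)
      assume "\<not> ?thesis"
      then have "0 < (1 / 2 :: real) \<and> (1 / 2 :: real) < 1 \<and>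
        1 / 2 * a x + (1 - 1 / 2) * a x \<le> 0 \<and> 1 / 2 * b x + (1 - 1 / 2) * b x \<le> 0" by auto
      with that neg show False by blast
    qed
    \<comment> \<open>At \<open>x\<close> one has \<open>b \<le> 0 < a\<close>, at \<open>y\<close>
      one has \<open>a \<le> 0 < b\<close>. If the segment between them did not pass strictly on the
      positive side of the origin, its crossing with \<open>a = 0\<close> would be a forbidden
      combination; \<open>s\<close> is the weight of that crossing.\<close>
    have strict: "a y * b x < a x * b y"
      if xy: "x \<in> space M" "G x" "b x \<le> 0" "y \<in> space M" "G y" "a y \<le> 0" for x y
    proof (rule ccontr)
      assume le: "\<not> ?thesis"
      have ax: "a x > 0" and bY: "b y > 0" using quad xy by fastforce+
      have ay: "a y < 0"
      proof (rule ccontr)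
        assume "\<not> a y < 0"
        then have "a y = 0" using xy by simp
        then show False using le mult_pos_pos[OF ax bY] by simp
      qed
      define s where "s = - a y / (a x - a y)"
      have "0 < a x - a y" using ax ay by simp
      then have s: "0 < s" "s < 1" using ax ay
        unfolding s_def by (simp_all only: zero_less_divide_iff pos_divide_less_eq) auto
      have s1: "1 - s = a x / (a x - a y)" using ax ay by (simp add: s_def field_simps)
      have "s * a x + (1 - s) * a y = (- a y * a x + a x * a y) / (a x - a y)"
        unfolding s1 by (simp add: s_def add_divide_distrib diff_divide_distrib)
      then have 1: "s * a x + (1 - s) * a y \<le> 0" by simp
      have "s * b x + (1 - s) * b y = (- a y * b x + a x * b y) / (a x - a y)"
        unfolding s1 by (simp add: s_def add_divide_distrib diff_divide_distrib)
      also have "\<dots> \<le> 0" using ax ay le by (intro divide_nonpos_pos) auto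
      finally show False using 1 s neg xy by blast
    qed
    define T where "T = {x \<in> space M. G x \<and> b x \<le> 0}"
    have "T \<noteq> {}" using ex_nonpos_of_expectation_nonpos[OF b(1) _ G] b(2) by (auto simp: T_def)
    have aT: "a x > 0" if "x \<in> T" for x using quad that by (fastforce simp: T_def)
    have bound: "- b x / a x \<le> b y / (- a y)"
      if "x \<in> T" "y \<in> space M" "G y" "a y < 0" for x y
      using strict[of x y] aT[OF that(1)] that
      by (simp add: T_def divide_simps mult.commute split: if_splits)
    have ex_neg: "\<exists>y\<in>space M. G y \<and> a y < 0"
    proof (rule ccontr)
      assume "\<not> ?thesis"
      then have nn: "AE x in M. 0 \<le> a x" using G by (auto elim!: eventually_elim2[OF _ AE_space])
      then have "AE x in M. a x = 0"
        using integral_nonneg_eq_0_iff_AE[OF a(1) nn] a(2) by simp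
      then have "AE x in M. G x \<and> a x = 0" using G by eventually_elim simp
      from ex_nonpos_of_expectation_nonpos[OF b(1) _ this] b(2) quad show False by fastforce
    qed
    then obtain y0 where y0: "y0 \<in> space M" "G y0" "a y0 < 0" by blast
    \<comment> \<open>Determines the supporting line: by \<open>bound\<close>, every ratio
      \<open>- b / a\<close> on \<open>T\<close> is at most every ratio \<open>b / (- a)\<close> at
      points with \<open>a < 0\<close>, and the supremum separates the two families.\<close>
    define m where "m = (SUP x\<in>T. - b x / a x)"
    have bdd: "bdd_above ((\<lambda>x. - b x / a x) ` T)"
      by (rule bdd_aboveI2[where M = "b y0 / - a y0"]) (rule bound[OF _ y0])
    have nn: "0 \<le> b x + m * a x" if x: "x \<in> space M" "G x" for x
    proof -
      obtain x0 where x0: "x0 \<in> T" using \<open>T \<noteq> {}\<close> by blast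
      have "0 \<le> - b x0 / a x0" using x0 aT[OF x0] by (intro divide_nonneg_pos) (auto simp: T_def)
      also have "\<dots> \<le> m" unfolding m_def by (rule cSUP_upper[OF x0 bdd])
      finally have m0: "0 \<le> m" .
      consider "x \<in> T" | "a x < 0" | "b x > 0" "a x \<ge> 0" using x by (force simp: T_def)
      then show ?thesis
      proof cases
        case 1
        have "- b x / a x \<le> m" unfolding m_def by (rule cSUP_upper[OF 1 bdd])
        then have "- b x \<le> m * a x" by (simp only: pos_divide_le_eq[OF aT[OF 1]])
        then show ?thesis by linarith
      next
        case 2
        have "m \<le> b x / (- a x)" unfolding m_def
          by (rule cSUP_least[OF \<open>T \<noteq> {}\<close>]) (use bound x 2 in auto)
        then have "m * (- a x) \<le> b x" using 2 by (subst (asm) pos_le_divide_eq) auto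
        then show ?thesis by simp
      next
        case 3
        then show ?thesis using m0 by simp
      qed
    qed
    have int: "integrable M (\<lambda>x. b x + m * a x)" using a b by simp
    have ae: "AE x in M. 0 \<le> b x + m * a x"
      using G nn by (auto elim!: eventually_elim2[OF _ AE_space])
    \<comment> \<open>Nonnegative with mean zero, so almost all values lie on the line
      \<open>b = - m * a\<close>. Points of it with \<open>b \<le> 0\<close> and with
      \<open>a \<le> 0\<close> then turn \<open>strict\<close> into an equality.\<close>
    have "AE x in M. b x + m * a x = 0"
      using integral_nonneg_eq_0_iff_AE[OF int ae] a b by simp
    then have G': "AE x in M. G x \<and> b x + m * a x = 0" using G by eventually_elim simp
    obtain x where x: "x \<in> space M" "G x" "b x = - m * a x" "b x \<le> 0"
      using ex_nonpos_of_expectation_nonpos[OF b(1) _ G'] b(2) by (auto simp: add_eq_0_iff)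
    obtain y where y: "y \<in> space M" "G y" "b y = - m * a y" "a y \<le> 0"
      using ex_nonpos_of_expectation_nonpos[OF a(1) _ G'] a(2) by (auto simp: add_eq_0_iff)
    show False using strict[of x y] x y by simp
  qed
  then obtain u v s where uv: "u \<in> space M" "v \<in> space M" "G u" "G v" "0 < s" "s < 1"
    "s * a u + (1 - s) * a v \<le> 0" "s * b u + (1 - s) * b v \<le> 0" by blast
  then have "s * f u + (1 - s) * f v \<le> expectation f" "s * g u + (1 - s) * g v \<le> expectation g"
    by (simp_all add: a_def b_def algebra_simps)
  with uv show ?thesis by blast
qed

text \<open>Pushing forward into \<open>M\<close> keeps its sigma-algebra, so measurability in
  products is unaffected when a factor is replaced.\<close>

definition two_point :: "'a measure \<Rightarrow> real \<Rightarrow> 'a \<Rightarrow> 'a \<Rightarrow> 'a measure" where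
  "two_point M s u v =
     distr (point_measure UNIV (\<lambda>b. ennreal (if b then s else 1 - s))) M (\<lambda>b. if b then u else v)"

lemma sets_two_point [simp, measurable_cong]: "sets (two_point M s u v) = sets M"
  and space_two_point [simp]: "space (two_point M s u v) = space M"
  by (simp_all add: two_point_def)

lemma
  assumes uv: "u \<in> space M" "v \<in> space M" and s: "0 < s" "s < 1"
  shows prob_space_two_point: "prob_space (two_point M s u v)"
    and nn_integral_two_point: "f \<in> borel_measurable M \<Longrightarrow>
      integral\<^sup>N (two_point M s u v) f = ennreal s * f u + ennreal (1 - s) * f v"
proof -
  have m: "(\<lambda>b. if b then u else v) \<in> measurable (point_measure UNIV (\<lambda>b. ennreal (if b then s else 1 - s))) M"
    using uv by (simp add: measurable_def space_point_measure sets_point_measure)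
  have "prob_space (point_measure UNIV (\<lambda>b. ennreal (if b then s else 1 - s)))"
    using s by (intro prob_space_point_measure) (auto simp: UNIV_bool simp flip: ennreal_plus)
  then show "prob_space (two_point M s u v)"
    unfolding two_point_def using m by (rule prob_space.prob_space_distr)
  show "f \<in> borel_measurable M \<Longrightarrow>
      integral\<^sup>N (two_point M s u v) f = ennreal s * f u + ennreal (1 - s) * f v"
    unfolding two_point_def
    by (subst nn_integral_distr[OF m]) (auto simp: nn_integral_point_measure_finite UNIV_bool)
qed

section \<open>Slicing finite products and replacing their factors\<close>

lemma emeasure_PiM_insert:
  fixes M :: "'i \<Rightarrow> 'a measure"
  assumes "\<And>i. prob_space (M i)" "finite J" "j \<notin> J" and E: "E \<in> sets (PiM (insert j J) M)"
  shows "emeasure (PiM (insert j J) M) E =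
      (\<integral>\<^sup>+ y. emeasure (PiM J M) {x \<in> space (PiM J M). x(j := y) \<in> E} \<partial>M j)"
    and "(\<lambda>y. emeasure (PiM J M) {x \<in> space (PiM J M). x(j := y) \<in> E}) \<in> borel_measurable (M j)"
    and "y \<in> space (M j) \<Longrightarrow> {x \<in> space (PiM J M). x(j := y) \<in> E} \<in> sets (PiM J M)"
proof -
  interpret product_prob_space M "insert j J"
    using assms(1) by (intro product_prob_spaceI)
  interpret J: prob_space "PiM J M" by (rule prob_space_PiM) (rule assms)
  have up: "(\<lambda>(y, x). x(j := y)) \<in> measurable (M j \<Otimes>\<^sub>M PiM J M) (PiM (insert j J) M)"
    using measurable_add_dim[of j J M]
    by (simp add: measurable_pair_swap_iff[of _ "M j"] case_prod_unfold)
  have mf: "(\<lambda>x. x(j := y)) \<in> measurable (PiM J M) (PiM (insert j J) M)" if "y \<in> space (M j)" for y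
    using measurable_compose[OF measurable_Pair1' up, OF that] by simp
  show sl: "{x \<in> space (PiM J M). x(j := y) \<in> E} \<in> sets (PiM J M)" if "y \<in> space (M j)" for y
    using measurable_sets[OF mf[OF that] E] by (simp add: vimage_def Int_def conj_commute)
  have ind: "(\<integral>\<^sup>+ x. indicator E (x(j := y)) \<partial>PiM J M) =
    emeasure (PiM J M) {x \<in> space (PiM J M). x(j := y) \<in> E}" if "y \<in> space (M j)" for y
    by (subst nn_integral_indicator[OF sl[OF that], symmetric])
       (auto intro!: nn_integral_cong simp: indicator_def)
  have "emeasure (PiM (insert j J) M) E = (\<integral>\<^sup>+ x. indicator E x \<partial>PiM (insert j J) M)"
    using E by simp
  also have "\<dots> = (\<integral>\<^sup>+ y. (\<integral>\<^sup>+ x. indicator E (x(j := y)) \<partial>PiM J M) \<partial>M j)"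
    using assms E by (subst product_nn_integral_insert_rev) auto
  also have "\<dots> = (\<integral>\<^sup>+ y. emeasure (PiM J M) {x \<in> space (PiM J M). x(j := y) \<in> E} \<partial>M j)"
    by (rule nn_integral_cong) (rule ind)
  finally show "emeasure (PiM (insert j J) M) E =
      (\<integral>\<^sup>+ y. emeasure (PiM J M) {x \<in> space (PiM J M). x(j := y) \<in> E} \<partial>M j)" .
  have "(\<lambda>y. \<integral>\<^sup>+ x. indicator E (x(j := y)) \<partial>PiM J M) \<in> borel_measurable (M j)"
    using measurable_compose[OF up borel_measurable_indicator[OF E]]
    by (intro J.borel_measurable_nn_integral) (simp add: case_prod_unfold)
  then show "(\<lambda>y. emeasure (PiM J M) {x \<in> space (PiM J M). x(j := y) \<in> E}) \<in> borel_measurable (M j)"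
    by (rule measurable_cong[THEN iffD1, rotated]) (rule ind)
qed

lemma emeasure_PiM_insert_two_point:
  fixes M :: "'i \<Rightarrow> 'a measure"
  assumes M: "\<And>i. prob_space (M i)" "finite J" "j \<notin> J" and E: "E \<in> sets (PiM (insert j J) M)"
    and Mj: "M j = two_point L s u v" "u \<in> space L" "v \<in> space L" "0 < s" "s < 1"
  shows "emeasure (PiM (insert j J) M) E =
      ennreal s * emeasure (PiM J M) {x \<in> space (PiM J M). x(j := u) \<in> E} +
      ennreal (1 - s) * emeasure (PiM J M) {x \<in> space (PiM J M). x(j := v) \<in> E}"
proof -
  define F where "F = (\<lambda>y. emeasure (PiM J M) {x \<in> space (PiM J M). x(j := y) \<in> E})"
  have "borel_measurable (M j) = (borel_measurable L :: ('a \<Rightarrow> ennreal) set)"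
    by (rule measurable_cong_sets) (simp_all add: Mj(1))
  then have "F \<in> borel_measurable L"
    using emeasure_PiM_insert(2)[OF assms(1-4)] by (simp add: F_def)
  from nn_integral_two_point[OF Mj(2-) this] show ?thesis
    unfolding emeasure_PiM_insert(1)[OF assms(1-4)] F_def[symmetric] Mj(1)[symmetric]
    by (simp add: F_def)
qed

text \<open>Only events \<open>p\<close> and \<open>q\<close> see coordinate \<open>j\<close>, so
  two slice measures have to be kept below their means. Both points are picked among the values
  whose slice of \<open>C\<close> is null, which is almost every value.\<close>

lemma replace_coordinate:
  fixes M :: "'i \<Rightarrow> 'a measure"
  assumes M: "\<And>i. prob_space (M i)" and J: "finite J" "j \<notin> J"
    and E: "\<And>k. k \<in> K \<Longrightarrow> E k \<in> sets (PiM (insert j J) M)"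
    and C: "C \<in> sets (PiM (insert j J) M)" "emeasure (PiM (insert j J) M) C = 0"
    and pq: "p \<in> K" "q \<in> K"
    and indep: "\<And>k x y y'. k \<in> K \<Longrightarrow> k \<noteq> p \<Longrightarrow> k \<noteq> q \<Longrightarrow> x \<in> space (PiM J M) \<Longrightarrow>
      y \<in> space (M j) \<Longrightarrow> y' \<in> space (M j) \<Longrightarrow> x(j := y) \<in> E k \<longleftrightarrow> x(j := y') \<in> E k"
  shows "\<exists>u\<in>space (M j). \<exists>v\<in>space (M j). \<exists>s. 0 < s \<and> s < 1 \<and>
    emeasure (PiM (insert j J) (M(j := two_point (M j) s u v))) C = 0 \<and>
    (\<forall>k\<in>K. emeasure (PiM (insert j J) (M(j := two_point (M j) s u v))) (E k)
       \<le> emeasure (PiM (insert j J) M) (E k))"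
proof -
  interpret j: prob_space "M j" by (rule M)
  interpret J: prob_space "PiM J M" by (rule prob_space_PiM) (rule M)
  define sl where "sl X y = {x \<in> space (PiM J M). x(j := y) \<in> X}" for X y
  define f where "f X y = measure (PiM J M) (sl X y)" for X y
  have f0: "0 \<le> f X y" for X y by (simp add: f_def)
  have ef: "emeasure (PiM J M) (sl X y) = ennreal (f X y)" for X y
    by (simp add: f_def J.emeasure_eq_measure)
  have meas: "f X \<in> borel_measurable (M j)" if "X \<in> sets (PiM (insert j J) M)" for X
  proof -
    have "f X = (\<lambda>y. enn2real (emeasure (PiM J M) (sl X y)))" by (simp add: fun_eq_iff f_def measure_def)
    then show ?thesis using emeasure_PiM_insert(2)[OF M J that] by (simp add: sl_def)
  qed
  have int: "integrable (M j) (f X)" if "X \<in> sets (PiM (insert j J) M)" for X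
    using meas[OF that] by (intro j.integrable_const_bound[where B = 1]) (auto simp: f_def)
  have em: "emeasure (PiM (insert j J) M) X = ennreal (integral\<^sup>L (M j) (f X))"
    if "X \<in> sets (PiM (insert j J) M)" for X
    unfolding emeasure_PiM_insert(1)[OF M J that] sl_def[symmetric] ef
    using int[OF that] by (intro nn_integral_eq_integral) (auto simp: f0)
  have "AE y in M j. emeasure (PiM J M) (sl C y) = 0"
    using C(2) emeasure_PiM_insert(2)[OF M J C(1)]
    unfolding emeasure_PiM_insert(1)[OF M J C(1)] sl_def[symmetric]
    by (subst (asm) nn_integral_0_iff_AE) auto
  from j.two_values_below_mean[OF int[OF E[OF pq(1)]] int[OF E[OF pq(2)]] this]
  obtain u v s where uv: "u \<in> space (M j)" "v \<in> space (M j)"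
    "emeasure (PiM J M) (sl C u) = 0" "emeasure (PiM J M) (sl C v) = 0" and s: "0 < s" "s < 1" and
    le: "s * f (E p) u + (1 - s) * f (E p) v \<le> integral\<^sup>L (M j) (f (E p))"
        "s * f (E q) u + (1 - s) * f (E q) v \<le> integral\<^sup>L (M j) (f (E q))"
    by blast
  define N where "N = M(j := two_point (M j) s u v)"
  have N: "prob_space (N i)" for i
    using M prob_space_two_point[OF uv(1,2) s] by (simp add: N_def)
  have setsN: "sets (PiM (insert j J) N) = sets (PiM (insert j J) M)"
    by (intro sets_PiM_cong) (auto simp: N_def)
  have NJ: "PiM J N = PiM J M" using J by (intro PiM_cong) (auto simp: N_def)
  have Nj: "N j = two_point (M j) s u v" by (simp add: N_def)
  have emN: "emeasure (PiM (insert j J) N) X =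
      ennreal s * ennreal (f X u) + ennreal (1 - s) * ennreal (f X v)"
    if "X \<in> sets (PiM (insert j J) M)" for X
  proof -
    have "X \<in> sets (PiM (insert j J) N)" using that by (simp add: setsN)
    from emeasure_PiM_insert_two_point[OF N J this Nj uv(1,2) s] show ?thesis
      by (simp add: NJ sl_def[symmetric] ef)
  qed
  have "emeasure (PiM (insert j J) N) C = 0"
    using emN[OF C(1)] uv(3,4) by (simp add: ef)
  moreover have "emeasure (PiM (insert j J) N) (E k) \<le> emeasure (PiM (insert j J) M) (E k)"
    if k: "k \<in> K" for k
  proof -
    have "s * f (E k) u + (1 - s) * f (E k) v \<le> integral\<^sup>L (M j) (f (E k))"
    proof (cases "k = p \<or> k = q")
      case False
      have const: "f (E k) y = f (E k) u" if "y \<in> space (M j)" for y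
        using indep[OF k _ _ _ that uv(1)] False unfolding f_def sl_def
        by (intro arg_cong[where f = "measure (PiM J M)"]) auto
      have "integral\<^sup>L (M j) (f (E k)) = integral\<^sup>L (M j) (\<lambda>_. f (E k) u)"
        by (rule Bochner_Integration.integral_cong) (auto simp: const)
      then show ?thesis using const[OF uv(2)] by (simp add: j.prob_space algebra_simps)
    qed (use le in auto)
    then show ?thesis
      unfolding emN[OF E[OF k]] em[OF E[OF k]] using s
      by (simp add: f0 ennreal_leI flip: ennreal_mult ennreal_plus)
  qed
  ultimately show ?thesis using uv s unfolding N_def by blast
qed

text \<open>Induction on the set \<open>L\<close> of replaced coordinates; \<open>p j\<close> and
  \<open>q j\<close> name the two events that see coordinate \<open>j\<close>. The functions
  \<open>s\<close>, \<open>u\<close>, \<open>v\<close> are admissible outside \<open>L\<close> too,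
  so that enlarging \<open>L\<close> is a plain update.\<close>

lemma two_point_discretization:
  fixes M :: "'i \<Rightarrow> 'a measure"
  assumes M: "\<And>i. prob_space (M i)" and I: "finite I" and "L \<subseteq> I"
    and E: "\<And>k. k \<in> K \<Longrightarrow> E k \<in> sets (PiM I M)"
    and C: "C \<in> sets (PiM I M)" "emeasure (PiM I M) C = 0"
    and pq: "\<And>j. j \<in> I \<Longrightarrow> p j \<in> K" "\<And>j. j \<in> I \<Longrightarrow> q j \<in> K"
    and indep: "\<And>j k x y y'. j \<in> I \<Longrightarrow> k \<in> K \<Longrightarrow> k \<noteq> p j \<Longrightarrow> k \<noteq> q j \<Longrightarrow>
      x \<in> space (PiM (I - {j}) M) \<Longrightarrow> y \<in> space (M j) \<Longrightarrow> y' \<in> space (M j) \<Longrightarrow>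
      x(j := y) \<in> E k \<longleftrightarrow> x(j := y') \<in> E k"
  shows "\<exists>s u v. (\<forall>i. 0 < s i \<and> s i < 1 \<and> u i \<in> space (M i) \<and> v i \<in> space (M i)) \<and>
    (let N = (\<lambda>i. if i \<in> L then two_point (M i) (s i) (u i) (v i) else M i) in
     emeasure (PiM I N) C = 0 \<and> (\<forall>k\<in>K. emeasure (PiM I N) (E k) \<le> emeasure (PiM I M) (E k)))"
  using finite_subset[OF \<open>L \<subseteq> I\<close> I] \<open>L \<subseteq> I\<close>
proof (induction L rule: finite_induct)
  case empty
  have "\<exists>x. \<forall>i. x i \<in> space (M i)"
    using prob_space.not_empty[OF M] by (meson all_not_in_conv)
  then obtain x where "\<forall>i. x i \<in> space (M i)" ..
  then show ?case using C by (intro exI[of _ "\<lambda>_. 1 / 2"] exI[of _ x]) (auto simp: Let_def)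
next
  case (insert j L)
  then obtain s u v where suv: "\<forall>i. 0 < s i \<and> s i < 1 \<and> u i \<in> space (M i) \<and> v i \<in> space (M i)"
    and "let N = (\<lambda>i. if i \<in> L then two_point (M i) (s i) (u i) (v i) else M i) in
     emeasure (PiM I N) C = 0 \<and> (\<forall>k\<in>K. emeasure (PiM I N) (E k) \<le> emeasure (PiM I M) (E k))"
    by auto
  then obtain N where N_def: "N = (\<lambda>i. if i \<in> L then two_point (M i) (s i) (u i) (v i) else M i)"
    and NC: "emeasure (PiM I N) C = 0"
    and NE: "\<forall>k\<in>K. emeasure (PiM I N) (E k) \<le> emeasure (PiM I M) (E k)"
    by (auto simp: Let_def)
  have N: "prob_space (N i)" for i
    using suv by (auto simp: N_def intro: M prob_space_two_point)
  have sp: "space (N i) = space (M i)" "sets (N i) = sets (M i)" for i by (auto simp: N_def)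
  have setsN: "sets (PiM X N) = sets (PiM X M)" for X
    by (intro sets_PiM_cong) (auto simp: N_def)
  have spN: "space (PiM X N) = space (PiM X M)" for X by (simp add: space_PiM sp)
  have Nj: "N j = M j" using insert by (simp add: N_def)
  define J where "J = I - {j}"
  have J: "finite J" "j \<notin> J" "insert j J = I" using I insert by (auto simp: J_def)
  have "j \<in> I" using insert by auto
  have "\<exists>u\<in>space (N j). \<exists>v\<in>space (N j). \<exists>s. 0 < s \<and> s < 1 \<and>
    emeasure (PiM (insert j J) (N(j := two_point (N j) s u v))) C = 0 \<and>
    (\<forall>k\<in>K. emeasure (PiM (insert j J) (N(j := two_point (N j) s u v))) (E k)
       \<le> emeasure (PiM (insert j J) N) (E k))"
  proof (rule replace_coordinate[OF N J(1,2) _ _ _ pq[OF \<open>j \<in> I\<close>]])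
    show "x(j := y) \<in> E k \<longleftrightarrow> x(j := y') \<in> E k"
      if "k \<in> K" "k \<noteq> p j" "k \<noteq> q j" "x \<in> space (PiM J N)" "y \<in> space (N j)" "y' \<in> space (N j)"
      for k x y y'
      using that unfolding spN sp J_def by (rule indep[OF \<open>j \<in> I\<close>])
  qed (use J(3) E C NC in \<open>auto simp: setsN\<close>)
  then obtain u' v' s' where n: "u' \<in> space (M j)" "v' \<in> space (M j)" "0 < s'" "s' < 1"
    "emeasure (PiM I (N(j := two_point (M j) s' u' v'))) C = 0"
    "\<forall>k\<in>K. emeasure (PiM I (N(j := two_point (M j) s' u' v'))) (E k) \<le> emeasure (PiM I N) (E k)"
    unfolding J(3) Nj by blast
  have "N(j := two_point (M j) s' u' v') = (\<lambda>i. if i \<in> insert j L then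
      two_point (M i) ((s(j := s')) i) ((u(j := u')) i) ((v(j := v')) i) else M i)"
    by (auto simp: N_def)
  with n NE suv show ?case
    by (intro exI[of _ "s(j := s')"] exI[of _ "u(j := u')"] exI[of _ "v(j := v')"])
       (auto simp: Let_def intro: order_trans)
qed

text \<open>Every choice of values has positive mass because \<open>0 < s i < 1\<close>, so it
  avoids every null set. This turns a cover up to measure zero into an exact boolean cover.\<close>

lemma two_point_null_set:
  fixes M :: "'i \<Rightarrow> 'a measure"
  assumes "finite I"
    and suv: "\<And>i. 0 < s i \<and> s i < (1::real) \<and> u i \<in> space (M i) \<and> v i \<in> space (M i)"
    and "C \<in> sets (PiM I M)" "emeasure (PiM I (\<lambda>i. two_point (M i) (s i) (u i) (v i))) C = 0"
  shows "(\<lambda>i\<in>I. if c i then u i else v i) \<notin> C"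
  using assms(1,3,4)
proof (induction I arbitrary: C rule: finite_induct)
  case empty
  then have C: "emeasure (count_space {\<lambda>_. undefined}) C = 0" "C \<subseteq> {\<lambda>_. undefined}"
    by (auto simp: PiM_empty)
  have "emeasure (count_space {\<lambda>_ :: 'i. undefined :: 'a}) {\<lambda>_. undefined} = 1"
    by (subst emeasure_count_space_finite) simp_all
  then have "C \<noteq> {\<lambda>_. undefined}" using C(1) by force
  then have "C = {}" using C(2) by (simp add: subset_singleton_iff)
  then show ?case by simp
next
  case (insert j J)
  let ?N = "\<lambda>i. two_point (M i) (s i) (u i) (v i)"
  have N: "prob_space (?N i)" for i using suv[of i] by (intro prob_space_two_point) auto
  have setsN: "sets (PiM X ?N) = sets (PiM X M)" for X by (intro sets_PiM_cong) auto
  have Cs: "C \<in> sets (PiM (insert j J) ?N)" using insert by (simp add: setsN)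
  define z where "z = (if c j then u j else v j)"
  have zs: "z \<in> space (?N j)" using suv[of j] by (simp add: z_def)
  have "emeasure (PiM J ?N) {x \<in> space (PiM J ?N). x(j := z) \<in> C} = 0"
    using emeasure_PiM_insert_two_point[OF N insert(1,2) Cs refl] suv[of j] insert.prems(2)
    by (auto simp: z_def)
  then have "(\<lambda>i\<in>J. if c i then u i else v i) \<notin> {x \<in> space (PiM J ?N). x(j := z) \<in> C}"
    using emeasure_PiM_insert(3)[OF N insert(1,2) Cs zs]
    by (intro insert.IH) (auto simp: setsN)
  moreover have "(\<lambda>i\<in>J. if c i then u i else v i) \<in> space (PiM J ?N)"
    using suv by (auto simp: space_PiM)
  moreover have "(\<lambda>i\<in>J. if c i then u i else v i)(j := z) = (\<lambda>i\<in>insert j J. if c i then u i else v i)"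
    using insert by (auto simp: z_def fun_eq_iff)
  ultimately show ?case by (simp only: mem_Collect_eq simp_thms)
qed

section \<open>No covers below the critical scale\<close>

text \<open>The coordinates other than \<open>a\<close> and \<open>b\<close> integrate out. In the
  representative point they take the value \<open>u i\<close>, because both implications are vacuous
  there.\<close>

lemma emeasure_two_point_pair:
  fixes M :: "'i \<Rightarrow> 'a measure"
  assumes I: "finite I" "a \<in> I" "b \<in> I" "a \<noteq> b"
    and suv: "\<And>i. 0 < s i \<and> s i < (1::real) \<and> u i \<in> space (M i) \<and> v i \<in> space (M i)"
    and E: "E \<in> sets (PiM I M)"
    and dep: "\<And>x x'. x \<in> space (PiM I M) \<Longrightarrow> x' \<in> space (PiM I M) \<Longrightarrow> x a = x' a \<Longrightarrow> x b = x' b \<Longrightarrow>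
      x \<in> E \<Longrightarrow> x' \<in> E"
  shows "emeasure (PiM I (\<lambda>i. two_point (M i) (s i) (u i) (v i))) E =
    ennreal (wt2 (\<lambda>c. if c then s a else 1 - s a) (\<lambda>c. if c then s b else 1 - s b)
      (\<lambda>\<alpha> \<beta>. (\<lambda>i\<in>I. if (i = a \<longrightarrow> \<alpha>) \<and> (i = b \<longrightarrow> \<beta>) then u i else v i) \<in> E))"
proof -
  let ?N = "\<lambda>i. two_point (M i) (s i) (u i) (v i)"
  define R where "R \<alpha> \<beta> \<longleftrightarrow> (\<lambda>i\<in>I. if (i = a \<longrightarrow> \<alpha>) \<and> (i = b \<longrightarrow> \<beta>) then u i else v i) \<in> E" for \<alpha> \<beta>
  define pick where "pick i \<alpha> = (if \<alpha> then u i else v i)" for i \<alpha>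
  have pick: "pick i \<alpha> \<in> space (M i)" for i \<alpha> using suv[of i] by (simp add: pick_def)
  have N: "prob_space (?N i)" for i using suv[of i] by (intro prob_space_two_point) auto
  have setsN: "sets (PiM X ?N) = sets (PiM X M)" for X by (intro sets_PiM_cong) auto
  define J where "J = I - {a}"
  define L where "L = I - {a, b}"
  have J: "finite J" "a \<notin> J" "I = insert a J" and L: "finite L" "b \<notin> L" "J = insert b L"
    using I by (auto simp: J_def L_def)
  define S where "S \<alpha> = {x \<in> space (PiM J ?N). x(a := pick a \<alpha>) \<in> E}" for \<alpha>
  interpret L: prob_space "PiM L ?N" by (rule prob_space_PiM) (rule N)
  have inner: "emeasure (PiM L ?N) {x \<in> space (PiM L ?N). x(b := pick b \<beta>) \<in> S \<alpha>} = of_bool (R \<alpha> \<beta>)"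
    for \<alpha> \<beta>
  proof -
    have "x(b := pick b \<beta>) \<in> S \<alpha> \<longleftrightarrow> R \<alpha> \<beta>" if x: "x \<in> space (PiM L ?N)" for x
    proof -
      have xb: "x(b := pick b \<beta>) \<in> space (PiM J ?N)"
        using x pick L by (auto simp: space_PiM PiE_iff extensional_def)
      then have xab: "x(b := pick b \<beta>, a := pick a \<alpha>) \<in> space (PiM I M)"
        using pick J by (auto simp: space_PiM PiE_iff extensional_def)
      have z: "(\<lambda>i\<in>I. if (i = a \<longrightarrow> \<alpha>) \<and> (i = b \<longrightarrow> \<beta>) then u i else v i) \<in> space (PiM I M)"
        using suv by (auto simp: space_PiM)
      show ?thesis
        unfolding S_def R_def using dep[OF xab z] dep[OF z xab] I xb by (auto simp: pick_def)
    qed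
    then have "{x \<in> space (PiM L ?N). x(b := pick b \<beta>) \<in> S \<alpha>} = (if R \<alpha> \<beta> then space (PiM L ?N) else {})"
      by auto
    then show ?thesis by (simp add: L.emeasure_space_1)
  qed
  have S: "S \<alpha> \<in> sets (PiM J ?N)" for \<alpha>
    unfolding S_def by (rule emeasure_PiM_insert(3)[OF N J(1,2)]) (use E J(3) pick in \<open>auto simp: setsN\<close>)
  have outer: "emeasure (PiM J ?N) (S \<alpha>) =
      ennreal (wt (\<lambda>c. if c then s b else 1 - s b) (R \<alpha>))" for \<alpha>
  proof -
    have Sb: "S \<alpha> \<in> sets (PiM (insert b L) ?N)" using S L(3) by simp
    have "emeasure (PiM J ?N) (S \<alpha>) = ennreal (s b) * of_bool (R \<alpha> True) +
      ennreal (1 - s b) * of_bool (R \<alpha> False)"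
      using emeasure_PiM_insert_two_point[OF N L(1,2) Sb refl] suv[of b] inner[of True \<alpha>] inner[of False \<alpha>]
      by (simp add: L(3) pick_def)
    then show ?thesis using suv[of b]
      by (cases "R \<alpha> True"; cases "R \<alpha> False") (simp_all add: wt_def flip: ennreal_plus)
  qed
  have E': "E \<in> sets (PiM (insert a J) ?N)" using E J(3) by (simp add: setsN)
  have "emeasure (PiM I ?N) E = ennreal (s a) * ennreal (wt (\<lambda>c. if c then s b else 1 - s b) (R True)) +
      ennreal (1 - s a) * ennreal (wt (\<lambda>c. if c then s b else 1 - s b) (R False))"
    using emeasure_PiM_insert_two_point[OF N J(1,2) E' refl] suv[of a] outer[of True] outer[of False]
    by (simp add: J(3) pick_def S_def)
  moreover have "0 \<le> wt (\<lambda>c. if c then s b else 1 - s b) T" for T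
    using suv[of b] by (intro wt_nonneg) auto
  ultimately show ?thesis using suv[of a]
    by (simp add: R_def[abs_def, symmetric] wt2_def flip: ennreal_mult ennreal_plus)
qed

lemma no_cover_product:
  fixes M :: "nat \<Rightarrow> 'a measure" and p :: "nat \<Rightarrow> real"
  assumes n: "3 \<le> n"
    and per: "\<And>k. p (k + n) = p k" and pos: "\<And>k. 0 < p k" and sub: "\<And>i. subcritical n p i"
    and M: "\<And>i. prob_space (M i)"
    and E: "\<And>k. k < n \<Longrightarrow> E k \<in> sets (PiM {..<n} M)"
    and p: "\<And>k. k < n \<Longrightarrow> emeasure (PiM {..<n} M) (E k) \<le> ennreal (p k)"
    and dep: "\<And>k x x'. k < n \<Longrightarrow> x \<in> space (PiM {..<n} M) \<Longrightarrow> x' \<in> space (PiM {..<n} M) \<Longrightarrow>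
      x k = x' k \<Longrightarrow> x (Suc k mod n) = x' (Suc k mod n) \<Longrightarrow> x \<in> E k \<Longrightarrow> x' \<in> E k"
  shows "emeasure (PiM {..<n} M) (space (PiM {..<n} M) - (\<Union>k<n. E k)) \<noteq> 0"
proof
  define C where "C = space (PiM {..<n} M) - (\<Union>k<n. E k)"
  assume "emeasure (PiM {..<n} M) (space (PiM {..<n} M) - (\<Union>k<n. E k)) = 0"
  then have C0: "emeasure (PiM {..<n} M) C = 0" by (simp add: C_def)
  have C: "C \<in> sets (PiM {..<n} M)"
    unfolding C_def using E by (intro sets.Diff sets.finite_UN) auto
  have dis: "\<exists>s u v. (\<forall>i. 0 < s i \<and> s i < 1 \<and> u i \<in> space (M i) \<and> v i \<in> space (M i)) \<and>
    (let N = (\<lambda>i. if i \<in> {..<n} then two_point (M i) (s i) (u i) (v i) else M i) in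
     emeasure (PiM {..<n} N) C = 0 \<and>
     (\<forall>k\<in>{..<n}. emeasure (PiM {..<n} N) (E k) \<le> emeasure (PiM {..<n} M) (E k)))"
  \<comment> \<open>Event \<open>k\<close> depends on the variables \<open>k\<close> and
    \<open>Suc k mod n\<close>, so variable \<open>j\<close> is seen by event \<open>j\<close> and
    its cyclic predecessor.\<close>
  proof (rule two_point_discretization[OF M, where p = "\<lambda>j. j" and q = "\<lambda>j. (j + n - 1) mod n"])
    show "x(j := y) \<in> E k \<longleftrightarrow> x(j := y') \<in> E k"
      if "j \<in> {..<n}" "k \<in> {..<n}" "k \<noteq> j" "k \<noteq> (j + n - 1) mod n"
        "x \<in> space (PiM ({..<n} - {j}) M)" "y \<in> space (M j)" "y' \<in> space (M j)" for j k x y y'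
    proof -
      have "Suc k mod n \<noteq> j"
        using that n by (cases "Suc k = n"; cases "j = 0") auto
      moreover have "x(j := z) \<in> space (PiM {..<n} M)" if "z \<in> space (M j)" for z
        using that \<open>x \<in> _\<close> \<open>j \<in> _\<close> by (auto simp: space_PiM PiE_iff extensional_def)
      ultimately show ?thesis
        using dep[of k "x(j := y)" "x(j := y')"] dep[of k "x(j := y')" "x(j := y)"] that by auto
    qed
  qed (use E C C0 n in auto)
  then obtain s u v where suv: "\<And>i. 0 < s i \<and> s i < 1 \<and> u i \<in> space (M i) \<and> v i \<in> space (M i)"
    and let': "let N = (\<lambda>i. if i \<in> {..<n} then two_point (M i) (s i) (u i) (v i) else M i) in
     emeasure (PiM {..<n} N) C = 0 \<and>
     (\<forall>k\<in>{..<n}. emeasure (PiM {..<n} N) (E k) \<le> emeasure (PiM {..<n} M) (E k))" by blast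
  define N where "N i = two_point (M i) (s i) (u i) (v i)" for i
  have "PiM {..<n} (\<lambda>i. if i \<in> {..<n} then two_point (M i) (s i) (u i) (v i) else M i) = PiM {..<n} N"
    by (intro PiM_cong) (auto simp: N_def)
  with let' have NC: "emeasure (PiM {..<n} N) C = 0"
    and NE: "emeasure (PiM {..<n} N) (E k) \<le> emeasure (PiM {..<n} M) (E k)" if "k < n" for k
    using that by (auto simp: Let_def)
  have NC0: "emeasure (PiM {..<n} (\<lambda>i. two_point (M i) (s i) (u i) (v i))) C = 0"
    using NC[of 0] n by (simp add: N_def[abs_def])
  define w where "w k c = (if c then s (k mod n) else 1 - s (k mod n))" for k c
  define Q where "Q k \<alpha> \<beta> \<longleftrightarrow> (\<lambda>i\<in>{..<n}. if (i = k mod n \<longrightarrow> \<alpha>) \<and> (i = Suc k mod n \<longrightarrow> \<beta>)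
    then u i else v i) \<in> E (k mod n)" for k \<alpha> \<beta>
  have Suc_ne: "k \<noteq> Suc k mod n" if "k < n" for k using that n by (cases "Suc k = n") auto
  have zs: "(\<lambda>i\<in>{..<n}. if c i then u i else v i) \<in> space (PiM {..<n} M)" for c
    using suv by (auto simp: space_PiM)
  show False
  proof (rule no_cover_bool[OF n per pos sub, where w = w and Q = Q])
    show "0 \<le> w k c" for k c using suv[of "k mod n"] by (simp add: w_def)
    show "w k True + w k False = 1" for k by (simp add: w_def)
    show "w (k + n) = w k" for k by (simp add: w_def fun_eq_iff)
    show "Q (k + n) = Q k" for k by (simp add: Q_def fun_eq_iff flip: mod_Suc_eq[of "k + n"] mod_Suc_eq[of k])
    show "wt2 (w k) (w (Suc k)) (Q k) \<le> p k" for k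
    proof -
      define r where "r = k mod n"
      have r: "r < n" using n by (simp add: r_def)
      have S: "Suc k mod n = Suc r mod n" by (simp add: r_def mod_Suc_eq)
      have w_r: "w k = (\<lambda>c. if c then s r else 1 - s r)"
        "w (Suc k) = (\<lambda>c. if c then s (Suc r mod n) else 1 - s (Suc r mod n))"
        by (simp_all add: fun_eq_iff w_def r_def S)
      have Q_r: "Q k = (\<lambda>\<alpha> \<beta>. (\<lambda>i\<in>{..<n}. if (i = r \<longrightarrow> \<alpha>) \<and> (i = Suc r mod n \<longrightarrow> \<beta>)
          then u i else v i) \<in> E r)"
        unfolding Q_def[abs_def] S r_def[symmetric] ..
      have "emeasure (PiM {..<n} N) (E r) = ennreal (wt2 (w k) (w (Suc k)) (Q k))"
        unfolding N_def[abs_def] w_r Q_r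
      proof (rule emeasure_two_point_pair[OF finite_lessThan _ _ Suc_ne[OF r] suv E[OF r]])
        show "x' \<in> E r" if "x \<in> space (PiM {..<n} M)" "x' \<in> space (PiM {..<n} M)" "x r = x' r"
          "x (Suc r mod n) = x' (Suc r mod n)" "x \<in> E r" for x x'
          using that by (rule dep[OF r])
      qed (use r n in auto)
      then have "ennreal (wt2 (w k) (w (Suc k)) (Q k)) \<le> ennreal (p r)"
        using NE[OF r] p[OF r] by simp
      then have "wt2 (w k) (w (Suc k)) (Q k) \<le> p r"
        using pos[of r] by (simp add: ennreal_le_iff)
      then show ?thesis using periodic_mod[of p n, OF per, of k] by (simp add: r_def)
    qed
    show "\<exists>k. Q k (c k) (c (Suc k))" if c: "\<And>k. c (k + n) = c k" for c
    proof -
      have "(\<lambda>i\<in>{..<n}. if c i then u i else v i) \<notin> C"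
        by (rule two_point_null_set[OF finite_lessThan suv C NC0])
      then obtain k where k: "k < n" "(\<lambda>i\<in>{..<n}. if c i then u i else v i) \<in> E k"
        using zs by (auto simp: C_def)
      have "c (Suc k) = c (Suc k mod n)" by (rule periodic_mod[of c n, OF c])
      \<comment> \<open>The event that catches \<open>c\<close> is decided by two coordinates, so
        all others may be reset to \<open>u\<close>.\<close>
      then have "Q k (c k) (c (Suc k))"
        unfolding Q_def using k dep[OF k(1) zs zs _ _ k(2)] n by auto
      then show ?thesis ..
    qed
  qed
qed

section \<open>Grouping the variables of a cyclic bigraph\<close>

lemma cyc_Suc: "cyc n (Suc k) = Suc (k mod n)"
  by (simp add: cyc_def)

lemma base_adjacent:
  assumes ce: "cycle_enumeration n E \<sigma>" and n: "3 \<le> n"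
    and r: "r < n" "t < n" "r \<noteq> t" and j: "j \<in> nbrs E (\<sigma> (Suc r))" "j \<in> nbrs E (\<sigma> (Suc t))"
  shows "t = Suc r mod n \<or> r = Suc t mod n"
proof -
  have bij: "bij_betw \<sigma> {1..n} {1..n}"
    and edges: "base_edges n E = (\<lambda>k. {\<sigma> k, \<sigma> (cyc n (k + 1))}) ` {1..n}"
    using ce by (auto simp: cycle_enumeration_def)
  have inj: "\<sigma> (Suc a) = \<sigma> (Suc b) \<longleftrightarrow> a = b" if "a < n" "b < n" for a b
    using inj_on_eq_iff[OF bij_betw_imp_inj_on[OF bij], of "Suc a" "Suc b"] that by simp
  have ran: "\<sigma> (Suc a) \<in> {1..n}" if "a < n" for a
    by (rule bij_betw_apply[OF bij]) (use that in simp)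
  have "{\<sigma> (Suc r), \<sigma> (Suc t)} \<in> base_edges n E"
    unfolding base_edges_def using ran[OF r(1)] ran[OF r(2)] inj[OF r(1,2)] r(3) j by blast
  then obtain k where k: "k \<in> {1..n}" "{\<sigma> (Suc r), \<sigma> (Suc t)} = {\<sigma> k, \<sigma> (cyc n (k + 1))}"
    unfolding edges by blast
  define c where "c = k - 1"
  have c: "c < n" "k = Suc c" using k by (auto simp: c_def)
  have "cyc n (k + 1) = Suc (Suc c mod n)" using c by (simp add: cyc_Suc)
  then have "{\<sigma> (Suc r), \<sigma> (Suc t)} = {\<sigma> (Suc c), \<sigma> (Suc (Suc c mod n))}" using k c by simp
  then show ?thesis
    using inj r c n by (auto simp: doubleton_eq_iff)
qed

text \<open>Three pairwise consecutive positions exist only on a cycle of length 3, where a variable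
  common to all events is excluded by definition.\<close>

lemma no_triple:
  assumes ce: "cycle_enumeration n E \<sigma>" and n: "3 \<le> n" and cyc: "n_cyclic n E"
    and abc: "a < n" "b < n" "c < n" "a \<noteq> b" "b \<noteq> c" "a \<noteq> c"
    and j: "j \<in> nbrs E (\<sigma> (Suc a))" "j \<in> nbrs E (\<sigma> (Suc b))" "j \<in> nbrs E (\<sigma> (Suc c))"
  shows False
proof -
  note adj = base_adjacent[OF ce n abc(1,2,4) j(1,2)] base_adjacent[OF ce n abc(2,3,5) j(2,3)]
    base_adjacent[OF ce n abc(1,3,6) j(1,3)]
  have n3: "n = 3"
    using adj abc n by (auto simp: mod_Suc split: if_splits)
  have "j \<in> nbrs E i" if "i \<in> {1..n}" for i
  proof -
    have "\<sigma> ` {1..n} = {1..n}" using ce by (auto simp: cycle_enumeration_def bij_betw_def)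
    then obtain k where k: "k \<in> {1..n}" "i = \<sigma> k" using \<open>i \<in> _\<close> by blast
    then have "k = Suc a \<or> k = Suc b \<or> k = Suc c" using abc n3 by auto
    with k j show ?thesis by blast
  qed
  moreover have "(\<Inter>i\<in>{1..n}. nbrs E i) = {}" using cyc n3 by (simp add: n_cyclic_def)
  ultimately show False by blast
qed

text \<open>A variable shared by events \<open>r\<close> and \<open>Suc r mod n\<close> goes to
  group \<open>Suc r mod n\<close>, and \<open>no_triple\<close> keeps all further events away from
  it. A private variable of event \<open>r\<close> goes to group \<open>r\<close>.\<close>

lemma variable_grouping:
  assumes ce: "cycle_enumeration n E \<sigma>" and n: "3 \<le> n" and cyc: "n_cyclic n E"
  shows "\<exists>\<gamma>. \<forall>j. \<gamma> j < n \<and> (\<forall>r<n. j \<in> nbrs E (\<sigma> (Suc r)) \<longrightarrow> \<gamma> j = r \<or> \<gamma> j = Suc r mod n)"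
proof (intro choice allI)
  fix j
  consider (two) r where "r < n" "j \<in> nbrs E (\<sigma> (Suc r))" "j \<in> nbrs E (\<sigma> (Suc (Suc r mod n)))"
    | (one) r where "r < n" "j \<in> nbrs E (\<sigma> (Suc r))"
        "\<forall>r<n. \<not> (j \<in> nbrs E (\<sigma> (Suc r)) \<and> j \<in> nbrs E (\<sigma> (Suc (Suc r mod n))))"
    | (none) "\<forall>r<n. j \<notin> nbrs E (\<sigma> (Suc r))" by blast
  then show "\<exists>g. g < n \<and> (\<forall>r<n. j \<in> nbrs E (\<sigma> (Suc r)) \<longrightarrow> g = r \<or> g = Suc r mod n)"
  proof cases
    case two
    have "r \<noteq> Suc r mod n" using two n by (cases "Suc r = n") auto
    moreover have "Suc r mod n < n" using n by simp
    ultimately have "t = r \<or> t = Suc r mod n" if "t < n" "j \<in> nbrs E (\<sigma> (Suc t))" for t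
      using no_triple[OF ce n cyc two(1) _ that(1) _ _ _ two(2,3) that(2)] by blast
    then show ?thesis using n by (intro exI[of _ "Suc r mod n"]) auto
  next
    case one
    have "t = r" if "t < n" "j \<in> nbrs E (\<sigma> (Suc t))" for t
      using base_adjacent[OF ce n one(1) that(1) _ one(2) that(2)] one that by blast
    then show ?thesis using one by blast
  next
    case none
    then show ?thesis using n by (intro exI[of _ 0]) auto
  qed
qed

text \<open>Supplies the variables on which the covering rectangles are built.\<close>

lemma shared_variable:
  assumes ce: "cycle_enumeration n E \<sigma>" and n: "3 \<le> n" and r: "r < n"
  shows "\<exists>j. j \<in> nbrs E (\<sigma> (Suc r)) \<and> j \<in> nbrs E (\<sigma> (Suc (Suc r mod n)))"
proof -
  have "cyc n (Suc r + 1) = Suc (Suc r mod n)" by (simp add: cyc_Suc)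
  then have "{\<sigma> (Suc r), \<sigma> (Suc (Suc r mod n))} \<in> base_edges n E"
    using ce r by (force simp: cycle_enumeration_def)
  then show ?thesis by (force simp: base_edges_def doubleton_eq_iff)
qed

text \<open>Both measures agree on rectangles, where the factors are merely collected by
  group.\<close>

lemma distr_PiM_regroup:
  fixes U :: "'i \<Rightarrow> 'a measure" and \<gamma> :: "'i \<Rightarrow> 'k"
  assumes U: "\<And>i. prob_space (U i)" and I: "finite I" and K: "finite K" "\<And>i. i \<in> I \<Longrightarrow> \<gamma> i \<in> K"
  shows "(\<lambda>y. \<lambda>i\<in>I. y (\<gamma> i) i) \<in> measurable (PiM K (\<lambda>k. PiM {i\<in>I. \<gamma> i = k} U)) (PiM I U)"
    and "distr (PiM K (\<lambda>k. PiM {i\<in>I. \<gamma> i = k} U)) (PiM I U) (\<lambda>y. \<lambda>i\<in>I. y (\<gamma> i) i) = PiM I U"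
proof -
  let ?M = "\<lambda>k. PiM {i\<in>I. \<gamma> i = k} U"
  interpret U: product_prob_space U I using U by (intro product_prob_spaceI)
  interpret M: product_prob_space ?M K
    by (intro product_prob_spaceI prob_space_PiM U)
  show meas: "(\<lambda>y. \<lambda>i\<in>I. y (\<gamma> i) i) \<in> measurable (PiM K ?M) (PiM I U)"
  proof (rule measurable_restrict)
    fix i assume i: "i \<in> I"
    have "(\<lambda>y. y (\<gamma> i)) \<in> measurable (PiM K ?M) (?M (\<gamma> i))"
      by (rule measurable_component_singleton[OF K(2)[OF i]])
    moreover have "(\<lambda>z. z i) \<in> measurable (?M (\<gamma> i)) (U i)"
      by (rule measurable_component_singleton) (use i in auto)
    ultimately show "(\<lambda>y. y (\<gamma> i) i) \<in> measurable (PiM K ?M) (U i)"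
      by (rule measurable_compose)
  qed
  show "distr (PiM K ?M) (PiM I U) (\<lambda>y. \<lambda>i\<in>I. y (\<gamma> i) i) = PiM I U"
  proof (rule U.PiM_eqI[OF I])
    fix A assume A: "\<And>i. i \<in> I \<Longrightarrow> A i \<in> sets (U i)"
    have "(\<lambda>y. \<lambda>i\<in>I. y (\<gamma> i) i) -` (PiE I A) \<inter> space (PiM K ?M) = PiE K (\<lambda>k. PiE {i\<in>I. \<gamma> i = k} A)"
    proof (intro set_eqI iffI)
      fix y assume y: "y \<in> (\<lambda>y. \<lambda>i\<in>I. y (\<gamma> i) i) -` (PiE I A) \<inter> space (PiM K ?M)"
      then show "y \<in> PiE K (\<lambda>k. PiE {i\<in>I. \<gamma> i = k} A)"
        by (auto simp: space_PiM PiE_iff)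
    next
      fix y assume y: "y \<in> PiE K (\<lambda>k. PiE {i\<in>I. \<gamma> i = k} A)"
      then show "y \<in> (\<lambda>y. \<lambda>i\<in>I. y (\<gamma> i) i) -` (PiE I A) \<inter> space (PiM K ?M)"
        using K(2) A[THEN sets.sets_into_space] by (fastforce simp: space_PiM PiE_iff)
    qed
    then have "emeasure (distr (PiM K ?M) (PiM I U) (\<lambda>y. \<lambda>i\<in>I. y (\<gamma> i) i)) (PiE I A) =
        emeasure (PiM K ?M) (PiE K (\<lambda>k. PiE {i\<in>I. \<gamma> i = k} A))"
      using A I by (subst emeasure_distr[OF meas]) (auto intro!: sets_PiM_I_finite)
    also have "\<dots> = (\<Prod>k\<in>K. emeasure (?M k) (PiE {i\<in>I. \<gamma> i = k} A))"
      using A I K by (intro M.emeasure_PiM) (auto intro!: sets_PiM_I_finite)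
    also have "\<dots> = (\<Prod>k\<in>K. \<Prod>i\<in>{i\<in>I. \<gamma> i = k}. emeasure (U i) (A i))"
      using A I by (intro prod.cong refl U.emeasure_PiM) auto
    also have "\<dots> = (\<Prod>i\<in>I. emeasure (U i) (A i))"
      using I K by (intro prod.group) auto
    finally show "emeasure (distr (PiM K ?M) (PiM I U) (\<lambda>y. \<lambda>i\<in>I. y (\<gamma> i) i)) (PiE I A) =
      (\<Prod>i\<in>I. emeasure (U i) (A i))" .
  qed simp
qed

abbreviation unit_interval :: "real measure" where
  "unit_interval \<equiv> restrict_space lborel {0..1}"

lemma prob_space_unit_interval: "prob_space unit_interval"
  by (rule prob_space_restrict_space) auto

text \<open>Conforming sets are only Lebesgue measurable. Enlarging the null part of
  \<open>B\<close> to a Borel null set costs no measure, and a superset is harmless since it leaves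
  less of the cube uncovered.\<close>

lemma conforms_measurable_superset:
  assumes J: "J \<subseteq> {1..m}"
    and B: "B \<in> sets (cube J)" and A: "A = prod_emb {1..m} (\<lambda>_. unit_interval) J B"
    and As: "A \<in> sets (cube {1..m})"
  shows "\<exists>B' \<in> sets (PiM J (\<lambda>_. unit_interval)).
    A \<subseteq> prod_emb {1..m} (\<lambda>_. unit_interval) J B' \<and>
    emeasure (PiM {1..m} (\<lambda>_. unit_interval)) (prod_emb {1..m} (\<lambda>_. unit_interval) J B')
      \<le> emeasure (cube {1..m}) A"
proof -
  let ?U = "\<lambda>_ :: nat. unit_interval"
  interpret U: product_prob_space ?U "{1..m}"
    by (intro product_prob_spaceI prob_space_unit_interval)
  obtain S N N' where SN: "B = S \<union> N" "N \<subseteq> N'" "N' \<in> null_sets (PiM J ?U)" "S \<in> sets (PiM J ?U)"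
    using B unfolding cube_def by (rule sets_completionE)
  define B' where "B' = S \<union> N'"
  have B': "B' \<in> sets (PiM J ?U)" using SN by (auto simp: B'_def)
  let ?e = "prod_emb {1..m} ?U J"
  have es: "?e X \<in> sets (PiM {1..m} ?U)" if "X \<in> sets (PiM J ?U)" for X
    using that J by (intro measurable_prod_emb) auto
  have "emeasure (PiM {1..m} ?U) (?e N') = emeasure (PiM J ?U) N'"
    using J SN by (intro U.emeasure_prod_emb) auto
  then have null: "emeasure (cube {1..m}) (?e N') = 0"
    using SN(3) es[OF null_setsD2[OF SN(3)]] by (simp add: cube_def null_setsD1)
  have sub: "?e B' \<subseteq> A \<union> ?e N'" by (auto simp: A B'_def SN prod_emb_def)
  have "emeasure (PiM {1..m} ?U) (?e B') = emeasure (cube {1..m}) (?e B')"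
    using es[OF B'] by (simp add: cube_def)
  also have "\<dots> \<le> emeasure (cube {1..m}) (A \<union> ?e N')"
    using sub As es[OF null_setsD2[OF SN(3)]] by (intro emeasure_mono) (auto simp: cube_def)
  also have "\<dots> \<le> emeasure (cube {1..m}) A + emeasure (cube {1..m}) (?e N')"
    using As es[OF null_setsD2[OF SN(3)]] by (intro emeasure_subadditive) (auto simp: cube_def)
  finally have "emeasure (PiM {1..m} ?U) (?e B') \<le> emeasure (cube {1..m}) A"
    unfolding null add_0_right .
  moreover have "A \<subseteq> ?e B'" using SN by (auto simp: A B'_def prod_emb_def)
  ultimately show ?thesis using B' by blast
qed

text \<open>The events are enlarged to Borel sets and pulled back along the regrouping map
  \<open>T\<close>, where event \<open>k\<close> depends only on the groups \<open>k\<close> and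
  \<open>Suc k mod n\<close>. As \<open>T\<close> preserves measure, the uncovered part has positive
  measure in the cube as well.\<close>

lemma subcritical_in_interior:
  fixes P :: "nat \<Rightarrow> real"
  assumes n: "3 \<le> n" and bi: "bigraph n m E" and cyc: "n_cyclic n E"
    and ce: "cycle_enumeration n E \<sigma>"
    and P: "\<And>i. i \<in> {1..n} \<Longrightarrow> 0 < P i \<and> P i < 1"
    and sub: "\<And>i. subcritical n (\<lambda>k. P (\<sigma> (Suc (k mod n)))) i"
  shows "P \<in> lll_interior n m E"
proof -
  have bij: "bij_betw \<sigma> {1..n} {1..n}" using ce by (simp add: cycle_enumeration_def)
  have ran: "\<sigma> (Suc k) \<in> {1..n}" if "k < n" for k
    by (rule bij_betw_apply[OF bij]) (use that in simp)
  have ex: "\<exists>k<n. i = \<sigma> (Suc k)" if "i \<in> {1..n}" for i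
  proof -
    have "i \<in> \<sigma> ` {1..n}" using bij that by (simp add: bij_betw_def)
    then obtain k where k: "k \<in> {1..n}" "i = \<sigma> k" by blast
    then show ?thesis by (intro exI[of _ "k - 1"]) auto
  qed
  have nb: "nbrs E i \<subseteq> {1..m}" for i using bi by (auto simp: bigraph_def nbrs_def)
  let ?U = "\<lambda>_ :: nat. unit_interval"
  let ?I = "{1..m}"
  have "measure (cube ?I) (\<Inter>i\<in>{1..n}. space (cube ?I) - A i) > 0"
    if conf: "conforms n m E A" and mA: "\<And>i. i \<in> {1..n} \<Longrightarrow> measure (cube ?I) (A i) = P i" for A
  proof -
    have U: "prob_space (PiM ?I ?U)" by (intro prob_space_PiM prob_space_unit_interval)
    interpret C: prob_space "cube ?I"
      unfolding cube_def by (rule prob_space.prob_space_completion[OF U])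
    have "\<exists>B'. B' \<in> sets (PiM (nbrs E i) ?U) \<and> A i \<subseteq> prod_emb ?I ?U (nbrs E i) B' \<and>
      emeasure (PiM ?I ?U) (prod_emb ?I ?U (nbrs E i) B') \<le> emeasure (cube ?I) (A i)"
      if i: "i \<in> {1..n}" for i
    proof -
      obtain B where "B \<in> sets (cube (nbrs E i))" "A i = prod_emb ?I ?U (nbrs E i) B"
        "A i \<in> sets (cube ?I)"
        using conf i unfolding conforms_def by blast
      from conforms_measurable_superset[OF nb this] show ?thesis by blast
    qed
    then have "\<forall>i\<in>{1..n}. \<exists>B'. B' \<in> sets (PiM (nbrs E i) ?U) \<and>
      A i \<subseteq> prod_emb ?I ?U (nbrs E i) B' \<and>
      emeasure (PiM ?I ?U) (prod_emb ?I ?U (nbrs E i) B') \<le> emeasure (cube ?I) (A i)"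
      by blast
    from bchoice[OF this] obtain B' where B': "\<And>i. i \<in> {1..n} \<Longrightarrow> B' i \<in> sets (PiM (nbrs E i) ?U)"
      "\<And>i. i \<in> {1..n} \<Longrightarrow> A i \<subseteq> prod_emb ?I ?U (nbrs E i) (B' i)"
      "\<And>i. i \<in> {1..n} \<Longrightarrow> emeasure (PiM ?I ?U) (prod_emb ?I ?U (nbrs E i) (B' i)) \<le> emeasure (cube ?I) (A i)"
      by blast
    define A' where "A' i = prod_emb ?I ?U (nbrs E i) (B' i)" for i
    have A's: "A' i \<in> sets (PiM ?I ?U)" if "i \<in> {1..n}" for i
      unfolding A'_def using B'(1)[OF that] nb by (intro measurable_prod_emb)
    have A'm: "emeasure (PiM ?I ?U) (A' i) \<le> ennreal (P i)" if "i \<in> {1..n}" for i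
      using B'(3)[OF that] unfolding A'_def C.emeasure_eq_measure mA[OF that] .
    obtain \<gamma> where g: "\<forall>j. \<gamma> j < n \<and>
        (\<forall>r<n. j \<in> nbrs E (\<sigma> (Suc r)) \<longrightarrow> \<gamma> j = r \<or> \<gamma> j = Suc r mod n)"
      using variable_grouping[OF ce n cyc] ..
    have \<gamma>: "\<gamma> j < n" "r < n \<Longrightarrow> j \<in> nbrs E (\<sigma> (Suc r)) \<Longrightarrow> \<gamma> j = r \<or> \<gamma> j = Suc r mod n" for j r
      using g by simp_all
    define M where "M k = PiM {j\<in>?I. \<gamma> j = k} ?U" for k
    define T where "T = (\<lambda>y :: nat \<Rightarrow> nat \<Rightarrow> real. \<lambda>j\<in>?I. y (\<gamma> j) j)"
    have T: "T \<in> measurable (PiM {..<n} M) (PiM ?I ?U)"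
      and dT: "distr (PiM {..<n} M) (PiM ?I ?U) T = PiM ?I ?U"
      using distr_PiM_regroup[OF prob_space_unit_interval, where I = ?I and K = "{..<n}" and \<gamma> = \<gamma>] \<gamma>(1)
      unfolding M_def[abs_def] T_def by auto
    define F where "F k = T -` A' (\<sigma> (Suc k)) \<inter> space (PiM {..<n} M)" for k
    have "emeasure (PiM {..<n} M) (space (PiM {..<n} M) - (\<Union>k<n. F k)) \<noteq> 0"
    proof (rule no_cover_product[OF n, where p = "\<lambda>k. P (\<sigma> (Suc (k mod n)))"])
      show "prob_space (M k)" for k
        unfolding M_def by (intro prob_space_PiM prob_space_unit_interval)
      show "F k \<in> sets (PiM {..<n} M)" if "k < n" for k
        unfolding F_def using T A's[OF ran[OF that]] by (rule measurable_sets)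
      show "emeasure (PiM {..<n} M) (F k) \<le> ennreal (P (\<sigma> (Suc (k mod n))))" if "k < n" for k
      proof -
        have "emeasure (PiM {..<n} M) (F k) = emeasure (PiM ?I ?U) (A' (\<sigma> (Suc k)))"
          unfolding F_def by (subst emeasure_distr[OF T A's[OF ran[OF that]], symmetric]) (simp only: dT)
        then show ?thesis using A'm[OF ran[OF that]] that by simp
      qed
      show "x' \<in> F k" if "k < n" "x \<in> space (PiM {..<n} M)" "x' \<in> space (PiM {..<n} M)"
        "x k = x' k" "x (Suc k mod n) = x' (Suc k mod n)" "x \<in> F k" for k x x'
      proof -
        have "restrict (T x) (nbrs E (\<sigma> (Suc k))) = restrict (T x') (nbrs E (\<sigma> (Suc k)))"
        proof (rule restrict_ext)
          fix j assume "j \<in> nbrs E (\<sigma> (Suc k))"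
          then have "\<gamma> j = k \<or> \<gamma> j = Suc k mod n" using \<gamma>(2) that(1) by blast
          then have "x (\<gamma> j) = x' (\<gamma> j)" using that(4,5) by auto
          then show "T x j = T x' j" by (simp add: T_def restrict_def)
        qed
        moreover have "T x' \<in> space (PiM ?I ?U)" using measurable_space[OF T that(3)] .
        ultimately show ?thesis using that(3,6) by (auto simp: F_def A'_def prod_emb_def space_PiM)
      qed
      show "0 < P (\<sigma> (Suc (k mod n)))" for k using P[OF ran[of "k mod n"]] n by simp
    qed (use sub in auto)
    moreover have "space (PiM {..<n} M) - (\<Union>k<n. F k) =
        T -` (space (PiM ?I ?U) - (\<Union>i\<in>{1..n}. A' i)) \<inter> space (PiM {..<n} M)"
      using measurable_space[OF T] ex ran by (fastforce simp: F_def)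
    moreover have s: "space (PiM ?I ?U) - (\<Union>i\<in>{1..n}. A' i) \<in> sets (PiM ?I ?U)"
      using A's by (intro sets.Diff sets.finite_UN) auto
    ultimately have "emeasure (PiM ?I ?U) (space (PiM ?I ?U) - (\<Union>i\<in>{1..n}. A' i)) \<noteq> 0"
      using emeasure_distr[OF T s] dT by simp
    then have "emeasure (cube ?I) (space (PiM ?I ?U) - (\<Union>i\<in>{1..n}. A' i)) \<noteq> 0"
      using s by (simp add: cube_def)
    moreover have "emeasure (cube ?I) (space (PiM ?I ?U) - (\<Union>i\<in>{1..n}. A' i))
        \<le> emeasure (cube ?I) (\<Inter>i\<in>{1..n}. space (cube ?I) - A i)"
    proof (rule emeasure_mono)
      have sub: "A i \<subseteq> A' i" if "i \<in> {1..n}" for i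
        unfolding A'_def by (rule B'(2)[OF that])
      show "space (PiM ?I ?U) - (\<Union>i\<in>{1..n}. A' i) \<subseteq> (\<Inter>i\<in>{1..n}. space (cube ?I) - A i)"
        unfolding cube_def space_completion using sub by blast
      have "A i \<in> sets (cube ?I)" if "i \<in> {1..n}" for i using conf that by (simp add: conforms_def)
      then show "(\<Inter>i\<in>{1..n}. space (cube ?I) - A i) \<in> sets (cube ?I)"
        using n by (intro sets.finite_INT sets.Diff) auto
    qed
    ultimately have "emeasure (cube ?I) (\<Inter>i\<in>{1..n}. space (cube ?I) - A i) \<noteq> 0" by auto
    then have "measure (cube ?I) (\<Inter>i\<in>{1..n}. space (cube ?I) - A i) \<noteq> 0"
      unfolding C.emeasure_eq_measure by simp
    then show ?thesis using measure_nonneg by (simp add: less_le)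
  qed
  then show ?thesis using P by (simp add: lll_interior_def)
qed

section \<open>The critical scale\<close>

lemma chain_pos:
  assumes "\<And>k. 0 < p k" "\<And>j. j < k \<Longrightarrow> chain p r j < 1"
  shows "0 < chain p r k"
  using assms by (cases k) auto

text \<open>The continuants of the recursion: \<open>1 - chain p r k\<close> is the quotient of two consecutive
  ones, so the recursion breaks down exactly where a continuant vanishes.\<close>

fun continuant :: "(nat \<Rightarrow> real) \<Rightarrow> nat \<Rightarrow> nat \<Rightarrow> real" where
  "continuant p r 0 = 1"
| "continuant p r (Suc 0) = 1 - p r"
| "continuant p r (Suc (Suc k)) = continuant p r (Suc k) - p (r + Suc k) * continuant p r k"

lemma chain_continuant:
  assumes "\<And>j. j \<le> k \<Longrightarrow> continuant p r j \<noteq> 0"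
  shows "1 - chain p r k = continuant p r (Suc k) / continuant p r k"
  using assms
proof (induction k)
  case (Suc k)
  then have "1 - chain p r k = continuant p r (Suc k) / continuant p r k" by simp
  with Suc.prems[of k] Suc.prems[of "Suc k"] show ?case by (simp add: diff_divide_distrib)
qed simp

lemma continuous_on_continuant: "continuous_on S (\<lambda>l. continuant (\<lambda>k. l * q k) r k)"
proof (induction k rule: induct_nat_012)
  case (ge2 k)
  then show ?case by (simp, intro continuous_intros)
qed (auto intro!: continuous_intros)

lemma continuant_zero: "continuant (\<lambda>k. 0 * q k) r k = 1"
  by (induction k rule: induct_nat_012) simp_all

lemma critical_scale:
  assumes n: "0 < n" and q: "\<And>k. 0 < q k"
  shows "\<exists>L>0. (\<forall>l. 0 < l \<and> l < L \<longrightarrow> subcritical n (\<lambda>k. l * q k) r) \<and>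
    (\<forall>j<n - 1. chain (\<lambda>k. L * q k) r j < 1) \<and> chain (\<lambda>k. L * q k) r (n - 1) = 1"
proof -
  define D where "D l k = continuant (\<lambda>k. l * q k) r k" for l k
  \<comment> \<open>Scales at which some continuant has ceased to be positive; the critical scale is
    the least of them. At \<open>1 / q r\<close> the continuant of index 1 vanishes.\<close>
  define Z where "Z = {0..} \<inter> (\<Union>k\<in>{..n}. {l. D l k \<le> 0})"
  have closed: "closed Z"
    unfolding Z_def D_def
    by (intro closed_Int closed_UN ballI closed_Collect_le continuous_on_continuant) auto
  have "1 / q r \<in> Z"
  proof -
    have "D (1 / q r) 1 \<le> 0" "0 \<le> 1 / q r" using q[of r] by (simp_all add: D_def)
    then show ?thesis unfolding Z_def using n by (intro IntI UN_I[of 1]) auto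
  qed
  define L where "L = Inf Z"
  have bdd: "bdd_below Z" by (rule bdd_belowI[of _ 0]) (auto simp: Z_def)
  have LZ: "L \<in> Z" unfolding L_def using closed bdd \<open>1 / q r \<in> Z\<close> by (intro closed_contains_Inf) auto
  have L: "L > 0"
  proof -
    have "L \<noteq> 0" using LZ by (auto simp: Z_def D_def continuant_zero[simplified])
    then show ?thesis using LZ by (auto simp: Z_def)
  qed
  have pos: "D l k > 0" if "0 \<le> l" "l < L" "k \<le> n" for l k
  proof (rule ccontr)
    assume "\<not> D l k > 0"
    then have "l \<in> Z" using that by (auto simp: Z_def not_less intro!: bexI[of _ k])
    then have "L \<le> l" unfolding L_def by (rule cInf_lower[OF _ bdd])
    then show False using that by simp
  qed
  \<comment> \<open>All continuants equal 1 at scale 0, so a negative value at \<open>L\<close>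
    would force a zero strictly before \<open>L\<close>.\<close>
  have nonneg: "D L k \<ge> 0" if "k \<le> n" for k
  proof (rule ccontr)
    assume neg: "\<not> D L k \<ge> 0"
    have "\<exists>x\<ge>0. x \<le> L \<and> D x k = 0"
      by (rule IVT2') (use neg L in \<open>auto simp: D_def continuant_zero[simplified] continuous_on_continuant\<close>)
    then obtain x where x: "0 \<le> x" "x \<le> L" "D x k = 0" by blast
    then have "x \<noteq> L" using neg by auto
    with x pos[of x k] that show False by simp
  qed
  \<comment> \<open>A first zero at an index \<open>j < n\<close> would make the continuant of index
    \<open>Suc j\<close> negative by the three-term recursion. Hence only the last continuant
    vanishes at \<open>L\<close>.\<close>
  have posL: "D L k > 0" if "k < n" for k
  proof (rule ccontr)
    assume "\<not> D L k > 0"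
    then have z: "D L k = 0" using nonneg[of k] that by simp
    define j where "j = (LEAST j. D L j = 0)"
    have j: "D L j = 0" unfolding j_def by (rule LeastI[of _ k]) (rule z)
    have "j \<le> k" unfolding j_def by (rule Least_le) (rule z)
    have "j \<noteq> 0" using j by (cases j) (auto simp: D_def)
    then obtain i where i: "j = Suc i" by (cases j) auto
    have "D L i \<noteq> 0" using not_less_Least[of i "\<lambda>j. D L j = 0"] by (simp add: i j_def[symmetric])
    then have "D L i > 0" using nonneg[of i] i \<open>j \<le> k\<close> that by simp
    then have "L * q (r + j) * D L i > 0" using L q by simp
    then have "D L (Suc j) < 0" using j by (simp add: i D_def)
    then show False using nonneg[of "Suc j"] \<open>j \<le> k\<close> that by simp
  qed
  have "D L n = 0"
  proof -
    obtain k where "k \<le> n" "D L k \<le> 0" using LZ by (auto simp: Z_def)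
    then show ?thesis using posL[of k] nonneg[of n] by (cases "k = n") auto
  qed
  have "subcritical n (\<lambda>k. l * q k) r" if "0 < l" "l < L" for l
    unfolding subcritical_def
  proof (intro allI impI)
    fix j assume j: "j < n"
    have "1 - chain (\<lambda>k. l * q k) r j = D l (Suc j) / D l j"
      unfolding D_def
    proof (rule chain_continuant)
      show "continuant (\<lambda>k. l * q k) r i \<noteq> 0" if "i \<le> j" for i
        using pos[of l i] that j \<open>0 < l\<close> \<open>l < L\<close> by (simp add: D_def)
    qed
    also have "\<dots> > 0" using pos[of l j] pos[of l "Suc j"] that j by simp
    finally show "chain (\<lambda>k. l * q k) r j < 1" by simp
  qed
  moreover have chL: "1 - chain (\<lambda>k. L * q k) r j = D L (Suc j) / D L j" if "j < n" for j
    unfolding D_def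
  proof (rule chain_continuant)
    show "continuant (\<lambda>k. L * q k) r i \<noteq> 0" if "i \<le> j" for i
      using posL[of i] that \<open>j < n\<close> by (simp add: D_def)
  qed
  moreover have "chain (\<lambda>k. L * q k) r j < 1" if "j < n - 1" for j
    using chL[of j] posL[of j] posL[of "Suc j"] that by (smt (verit) Suc_lessD divide_pos_pos less_diff_conv Suc_eq_plus1)
  moreover have "chain (\<lambda>k. L * q k) r (n - 1) = 1"
    using chL[of "n - 1"] n \<open>D L n = 0\<close> by simp
  ultimately show ?thesis using L by blast
qed

text \<open>The system determines its unknowns one after another; both indices are one lower in
  \<open>chain\<close>.\<close>

lemma solves_system_chain:
  assumes n: "3 \<le> n" and r: "r < n" and sol: "solves_system n q (Suc r) l b"
    and k: "k < n - 1"
  shows "b (Suc k) = chain (\<lambda>k. l * q (Suc (k mod n))) r k"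
  using k
proof (induction k)
  case 0
  then show ?case using sol r by (simp add: solves_system_def)
next
  case (Suc k)
  have "b (Suc (Suc k)) = l * q (cyc n (Suc (Suc k) + Suc r - 1)) / (1 - b (Suc (Suc k) - 1))"
    using sol Suc.prems unfolding solves_system_def by (elim conjE ballE[of _ _ "Suc (Suc k)"]) auto
  also have "cyc n (Suc (Suc k) + Suc r - 1) = Suc ((r + Suc k) mod n)"
    using cyc_Suc[of n "r + Suc k"] by (simp add: ac_simps)
  finally show ?case using Suc by simp
qed

lemma cyc_pred: "r < n \<Longrightarrow> cyc n r = Suc ((r + (n - 1)) mod n)"
  by (simp add: cyc_def)

text \<open>Given the recursion, the closing equation says that the term of index
  \<open>n - 1\<close> equals 1, which subcriticality excludes at every smaller scale.\<close>

lemma is_min_scale_critical: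
  assumes n: "3 \<le> n" and r: "r < n" and q: "\<And>k. 0 < q (Suc (k mod n))"
    and L: "0 < L"
    and sub: "\<And>l. 0 < l \<Longrightarrow> l < L \<Longrightarrow> subcritical n (\<lambda>k. l * q (Suc (k mod n))) r"
    and lt: "\<And>j. j < n - 1 \<Longrightarrow> chain (\<lambda>k. L * q (Suc (k mod n))) r j < 1"
    and last: "chain (\<lambda>k. L * q (Suc (k mod n))) r (n - 1) = 1"
  shows "is_min_scale n q (Suc r) L"
proof -
  have step: "chain p r (n - 1) = p (r + (n - 1)) / (1 - chain p r (n - 2))" for p
  proof -
    have "n - 1 = Suc (n - 2)" using n by simp
    then show ?thesis by (simp only: chain.simps)
  qed
  have "solves_system n q (Suc r) L (\<lambda>k. chain (\<lambda>k. L * q (Suc (k mod n))) r (k - 1))"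
    unfolding solves_system_def
  proof (intro conjI ballI)
    fix k assume k: "k \<in> {2..n - 1}"
    then have "k - 1 - 1 < n - 1" using n by auto
    from lt[OF this] show "chain (\<lambda>k. L * q (Suc (k mod n))) r (k - 1 - 1) \<noteq> 1" by simp
    have "cyc n (k + Suc r - 1) = Suc ((r + (k - 1)) mod n)"
      using cyc_Suc[of n "r + (k - 1)"] k by (simp add: ac_simps)
    moreover have "k - 1 = Suc (k - 1 - 1)" using k by auto
    ultimately show "chain (\<lambda>k. L * q (Suc (k mod n))) r (k - 1) =
      L * q (cyc n (k + Suc r - 1)) / (1 - chain (\<lambda>k. L * q (Suc (k mod n))) r (k - 1 - 1))"
      by (metis chain.simps(2))
  next
    have "1 - chain (\<lambda>k. L * q (Suc (k mod n))) r (n - 2) > 0" using lt[of "n - 2"] n by simp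
    then have "L * q (Suc ((r + (n - 1)) mod n)) = 1 - chain (\<lambda>k. L * q (Suc (k mod n))) r (n - 2)"
      using last unfolding step by (simp add: divide_eq_1_iff)
    then show "chain (\<lambda>k. L * q (Suc (k mod n))) r (n - 1 - 1) = 1 - L * q (cyc n (Suc r - 1))"
      using cyc_pred[OF r] by (simp add: numeral_2_eq_2)
  qed (use r in auto)
  moreover have "L \<le> l" if l: "0 < l" "solves_system n q (Suc r) l b" for l b
  proof (rule ccontr)
    assume "\<not> ?thesis"
    then have sb: "subcritical n (\<lambda>k. l * q (Suc (k mod n))) r" using sub l by simp
    have "b (n - 1) = chain (\<lambda>k. l * q (Suc (k mod n))) r (n - 2)"
      using solves_system_chain[OF n r l(2), of "n - 2"] n by (simp add: numeral_2_eq_2 Suc_diff_Suc)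
    moreover have "b (n - 1) = 1 - l * q (Suc ((r + (n - 1)) mod n))"
      using l(2) cyc_pred[OF r] by (simp add: solves_system_def)
    ultimately have "1 - chain (\<lambda>k. l * q (Suc (k mod n))) r (n - 2) = l * q (Suc ((r + (n - 1)) mod n))"
      by simp
    moreover have "l * q (Suc ((r + (n - 1)) mod n)) \<noteq> 0"
      using mult_pos_pos[OF l(1) q[of "r + (n - 1)"]] by linarith
    ultimately have "chain (\<lambda>k. l * q (Suc (k mod n))) r (n - 1) = 1"
      unfolding step by simp
    moreover have "chain (\<lambda>k. l * q (Suc (k mod n))) r (n - 1) < 1"
      using sb n by (simp add: subcritical_def)
    ultimately show False by simp
  qed
  ultimately show ?thesis using L by (auto simp: is_min_scale_def)
qed

text \<open>Grows a covering rectangle to the exact probability \<open>\<tau>\<close>: the lower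
  bound is decreased first, and \<open>d\<close> is raised to \<open>\<tau>\<close> only if even
  \<open>c = 0\<close> is too little.\<close>

lemma enlarge_rectangle:
  fixes \<beta> \<delta> \<tau> :: real
  assumes "0 \<le> \<beta>" "\<beta> < 1" "0 < \<delta>" "\<delta> \<le> 1" "(1 - \<beta>) * \<delta> \<le> \<tau>" "\<tau> < 1"
  shows "\<exists>c d. 0 \<le> c \<and> c \<le> \<beta> \<and> \<delta> \<le> d \<and> d \<le> 1 \<and> (1 - c) * d = \<tau>"
proof -
  define d where "d = max \<delta> \<tau>"
  have d: "0 < d" "\<delta> \<le> d" "d \<le> 1" "\<tau> \<le> d" using assms by (auto simp: d_def)
  have "0 \<le> 1 - \<tau> / d" using d by simp
  moreover have "(1 - \<beta>) * d \<le> \<tau>"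
  proof (cases "\<delta> \<le> \<tau>")
    case True
    then have d\<tau>: "d = \<tau>" by (simp add: d_def)
    have "0 \<le> \<beta> * \<tau>" using d assms d\<tau> by simp
    then show ?thesis unfolding d\<tau> by (simp add: algebra_simps)
  next
    case False
    then show ?thesis using assms by (simp add: d_def max_def)
  qed
  then have "1 - \<beta> \<le> \<tau> / d" using d by (simp add: pos_le_divide_eq)
  moreover have "(1 - (1 - \<tau> / d)) * d = \<tau>" using d by simp
  ultimately show ?thesis using d by (intro exI[of _ "1 - \<tau> / d"] exI[of _ d]) auto
qed

lemma measure_rectangle:
  assumes ab: "a \<in> {1..m}" "b \<in> {1..m}" "a \<noteq> b" and cd: "0 \<le> c" "c \<le> 1" "0 \<le> d" "d \<le> 1"
  shows "measure (cube {1..m}) {x \<in> space (cube {1..m}). c \<le> x a \<and> x b \<le> d} = (1 - c) * d"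
proof -
  let ?U = "\<lambda>_ :: nat. unit_interval"
  interpret U: product_prob_space ?U "{1..m}"
    by (intro product_prob_spaceI prob_space_unit_interval)
  define X where "X i = (if i = a then {c..1} else {0..d})" for i
  have X: "X i \<in> sets unit_interval" for i
    using cd by (auto simp: X_def sets_restrict_space_iff)
  have eq: "{x \<in> space (cube {1..m}). c \<le> x a \<and> x b \<le> d} =
      {x \<in> space (PiM {1..m} ?U). \<forall>i\<in>{a, b}. x i \<in> X i}"
    using ab cd by (auto simp: cube_def space_PiM PiE_iff X_def)
  have "emeasure (PiM {1..m} ?U) {x \<in> space (PiM {1..m} ?U). \<forall>i\<in>{a, b}. x i \<in> X i} =
      (\<Prod>i\<in>{a, b}. emeasure unit_interval (X i))"
    using ab X by (intro U.emeasure_PiM_Collect) auto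
  also have "\<dots> = ennreal (1 - c) * ennreal d"
    using ab cd by (simp add: X_def emeasure_restrict_space)
  also have "\<dots> = ennreal ((1 - c) * d)" using cd by (simp add: ennreal_mult)
  finally have "emeasure (PiM {1..m} ?U) {x \<in> space (PiM {1..m} ?U). \<forall>i\<in>{a, b}. x i \<in> X i} =
      ennreal ((1 - c) * d)" .
  moreover have "{x \<in> space (PiM {1..m} ?U). \<forall>i\<in>{a, b}. x i \<in> X i} \<in> sets (PiM {1..m} ?U)"
    using ab X by (intro sets.sets_Collect_finite_All sets_Collect_single) auto
  ultimately show ?thesis
    unfolding eq using cd by (simp add: cube_def measure_def)
qed

lemma rectangle_conforms:
  assumes "N \<subseteq> I" "a \<in> N" "b \<in> N"
  shows "{x \<in> space (cube I). c \<le> x a \<and> x b \<le> d} \<in> sets (cube I)"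
    and "{x \<in> space (cube I). c \<le> x a \<and> x b \<le> d} =
      prod_emb I (\<lambda>_. unit_interval) N {x \<in> space (cube N). c \<le> x a \<and> x b \<le> d}"
proof -
  have [measurable]: "(\<lambda>x. x i) \<in> borel_measurable (cube J)" if "i \<in> J" for i :: nat and J
  proof -
    have "(\<lambda>x. x i) \<in> measurable (PiM J (\<lambda>_. unit_interval)) unit_interval"
      by (rule measurable_component_singleton[OF that])
    then have "(\<lambda>x. x i) \<in> borel_measurable (PiM J (\<lambda>_. unit_interval))"
      by (simp add: measurable_restrict_space2_iff)
    then show ?thesis unfolding cube_def by (rule measurable_completion)
  qed
  have [measurable]: "(\<lambda>x. x a) \<in> borel_measurable (cube I)" "(\<lambda>x. x b) \<in> borel_measurable (cube I)"
    using assms by auto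
  show "{x \<in> space (cube I). c \<le> x a \<and> x b \<le> d} \<in> sets (cube I)" by measurable
  show "{x \<in> space (cube I). c \<le> x a \<and> x b \<le> d} =
      prod_emb I (\<lambda>_. unit_interval) N {x \<in> space (cube N). c \<le> x a \<and> x b \<le> d}"
    using assms by (auto simp: prod_emb_def cube_def space_PiM PiE_iff subset_eq dest: extensional_arb)
qed

section \<open>Covers above the critical scale\<close>

text \<open>The rectangles belonging to the critical \<open>p\<close> already cover; enlarging each
  to measure exactly \<open>P i\<close> keeps the cover. The assumption to be refuted contains
  \<open>P i < 1\<close>, so larger values require no construction.\<close>

lemma critical_not_in_interior:
  fixes P p :: "nat \<Rightarrow> real"
  assumes n: "3 \<le> n" and bi: "bigraph n m E" and cyc: "n_cyclic n E"
    and ce: "cycle_enumeration n E \<sigma>" and r: "r < n"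
    and p: "\<And>i. i \<in> {1..n} \<Longrightarrow> 0 < p i \<and> p i \<le> P i"
    and lt: "\<And>j. j < n - 1 \<Longrightarrow> chain (\<lambda>k. p (\<sigma> (Suc (k mod n)))) r j < 1"
    and last: "chain (\<lambda>k. p (\<sigma> (Suc (k mod n)))) r (n - 1) = 1"
  shows "P \<notin> lll_interior n m E"
proof
  assume "P \<in> lll_interior n m E"
  then have P1: "\<And>i. i \<in> {1..n} \<Longrightarrow> 0 < P i \<and> P i < 1"
    and int: "\<And>A. conforms n m E A \<Longrightarrow> (\<And>i. i \<in> {1..n} \<Longrightarrow> measure (cube {1..m}) (A i) = P i) \<Longrightarrow>
      measure (cube {1..m}) (\<Inter>i\<in>{1..n}. space (cube {1..m}) - A i) > 0"
    by (auto simp: lll_interior_def)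
  have bij: "bij_betw \<sigma> {1..n} {1..n}" using ce by (simp add: cycle_enumeration_def)
  have ran: "\<sigma> (Suc k) \<in> {1..n}" if "k < n" for k
    by (rule bij_betw_apply[OF bij]) (use that in simp)
  have nb: "nbrs E i \<subseteq> {1..m}" for i using bi by (auto simp: bigraph_def nbrs_def)
  define q where "q k = p (\<sigma> (Suc (k mod n)))" for k
  define Q where "Q k = P (\<sigma> (Suc (k mod n)))" for k
  have Q: "0 < q k" "q k \<le> Q k" "Q k < 1" for k
    using p[OF ran[of "k mod n"]] P1[OF ran[of "k mod n"]] n by (auto simp: q_def Q_def)
  define b where "b = chain q r"
  have b: "0 < b t" "b t \<le> 1" "t < n - 1 \<Longrightarrow> b t < 1" if "t < n" for t
  proof -
    have *: "b j < 1" if "j < n - 1" for j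
      using lt[OF that] by (simp add: b_def q_def[abs_def])
    show "0 < b t" unfolding b_def
      by (rule chain_pos) (use Q * that in \<open>auto simp: b_def\<close>)
    show "t < n - 1 \<Longrightarrow> b t < 1" by (rule *)
    show "b t \<le> 1"
    proof (cases "t < n - 1")
      case True
      then show ?thesis using *[of t] by simp
    next
      case False
      then have "t = n - 1" using that by simp
      then show ?thesis using last by (simp add: b_def q_def[abs_def])
    qed
  qed
  have bn: "b (n - 1) = 1" using last by (simp add: b_def q_def[abs_def])
  \<comment> \<open>The threshold left by the preceding event; the value \<open>0\<close> means that
    the first event of the path imposes no lower bound.\<close>
  define bb where "bb t = (case t of 0 \<Rightarrow> 0 | Suc t \<Rightarrow> b t)" for t
  have "\<exists>c d. 0 \<le> c \<and> c \<le> bb t \<and> b t \<le> d \<and> d \<le> 1 \<and> (1 - c) * d = Q (r + t)" if t: "t < n" for t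
  proof (rule enlarge_rectangle)
    show "0 \<le> bb t" "bb t < 1" using b[of "t - 1"] t by (auto simp: bb_def split: nat.split)
    have "(1 - bb t) * b t = q (r + t)"
    proof (cases t)
      case 0
      then show ?thesis by (simp add: bb_def b_def)
    next
      case (Suc u)
      then have "b u < 1" using b(3)[of u] t by simp
      then show ?thesis by (simp add: Suc bb_def b_def)
    qed
    then show "(1 - bb t) * b t \<le> Q (r + t)" using Q by simp
  qed (use b t Q in auto)
  then have "\<forall>t\<in>{..<n}. \<exists>c d. 0 \<le> c \<and> c \<le> bb t \<and> b t \<le> d \<and> d \<le> 1 \<and> (1 - c) * d = Q (r + t)"
    by blast
  then obtain c d where cd: "\<And>t. t < n \<Longrightarrow> 0 \<le> c t \<and> c t \<le> bb t \<and> b t \<le> d t \<and> d t \<le> 1 \<and>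
      (1 - c t) * d t = Q (r + t)"
    by (metis lessThan_iff)
  have "\<forall>k\<in>{..<n}. \<exists>j. j \<in> nbrs E (\<sigma> (Suc k)) \<and> j \<in> nbrs E (\<sigma> (Suc (Suc k mod n)))"
    using shared_variable[OF ce n] by blast
  from bchoice[OF this] obtain v where v: "\<And>k. k < n \<Longrightarrow> v k \<in> nbrs E (\<sigma> (Suc k))"
    "\<And>k. k < n \<Longrightarrow> v k \<in> nbrs E (\<sigma> (Suc (Suc k mod n)))" by auto
  define pre where "pre k = (k + n - 1) mod n" for k
  have pre: "pre k < n" "Suc (pre k) mod n = k mod n" for k
    using n by (auto simp: pre_def mod_Suc_eq)
  have pre_Suc: "pre (Suc s mod n) = s" if "s < n" for s
    using that by (cases "Suc s = n") (auto simp: pre_def)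
  have vpre: "v (pre k) \<in> nbrs E (\<sigma> (Suc k))" if "k < n" for k
    using v(2)[OF pre(1)[of k]] that by (simp add: pre)
  \<comment> \<open>Otherwise one variable would be seen by the three events \<open>pre k\<close>,
    \<open>k\<close> and \<open>Suc k mod n\<close>.\<close>
  have v_ne: "v (pre k) \<noteq> v k" if k: "k < n" for k
  proof
    assume eq: "v (pre k) = v k"
    have "pre k \<noteq> k" "k \<noteq> Suc k mod n" "pre k \<noteq> Suc k mod n"
      using k n by (auto simp: pre_def mod_Suc mod_if)
    moreover have "Suc k mod n < n" using n by simp
    ultimately show False
      using no_triple[OF ce n cyc pre(1) k, of "Suc k mod n" k "v k"] v[OF k] v(1)[OF pre(1), of k] eq
      by metis
  qed
  define \<kappa> where "\<kappa> i = the_inv_into {1..n} \<sigma> i - 1" for i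
  have \<kappa>: "\<kappa> (\<sigma> (Suc k)) = k" if "k < n" for k
    using that the_inv_into_f_f[OF bij_betw_imp_inj_on[OF bij], of "Suc k"] by (simp add: \<kappa>_def)
  have ex: "\<exists>k<n. i = \<sigma> (Suc k)" if "i \<in> {1..n}" for i
  proof -
    have "i \<in> \<sigma> ` {1..n}" using bij that by (simp add: bij_betw_def)
    then obtain k where k: "k \<in> {1..n}" "i = \<sigma> k" by blast
    then show ?thesis by (intro exI[of _ "k - 1"]) auto
  qed
  \<comment> \<open>The position of event \<open>k\<close> on the path that starts at event
    \<open>r\<close>.\<close>
  define tt where "tt k = (k + n - r) mod n" for k
  define A where "A i = {x \<in> space (cube {1..m}). c (tt (\<kappa> i)) \<le> x (v (pre (\<kappa> i))) \<and>
    x (v (\<kappa> i)) \<le> d (tt (\<kappa> i))}" for i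
  have tt: "tt k < n" "Q (r + tt k) = Q k" for k
  proof -
    show "tt k < n" using n by (simp add: tt_def)
    have "(r + tt k) mod n = k mod n" using r by (simp add: tt_def mod_add_right_eq)
    then show "Q (r + tt k) = Q k" by (simp add: Q_def)
  qed
  have "conforms n m E A"
    unfolding conforms_def
  proof (intro ballI conjI)
    fix i assume i: "i \<in> {1..n}"
    then obtain k where k: "k < n" "i = \<sigma> (Suc k)" using ex by blast
    have N: "v (pre (\<kappa> i)) \<in> nbrs E i" "v (\<kappa> i) \<in> nbrs E i"
      using k \<kappa> vpre v by auto
    show "A i \<in> sets (cube {1..m})" unfolding A_def by (rule rectangle_conforms[OF nb N])
    have "{x \<in> space (cube (nbrs E i)). c (tt (\<kappa> i)) \<le> x (v (pre (\<kappa> i))) \<and>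
        x (v (\<kappa> i)) \<le> d (tt (\<kappa> i))} \<in> sets (cube (nbrs E i))"
      by (rule rectangle_conforms[OF subset_refl N])
    then show "\<exists>B\<in>sets (cube (nbrs E i)). A i = prod_emb {1..m} (\<lambda>_. unit_interval) (nbrs E i) B"
      unfolding A_def rectangle_conforms(2)[OF nb N] by blast
  qed
  moreover have "measure (cube {1..m}) (A i) = P i" if i: "i \<in> {1..n}" for i
  proof -
    obtain k where k: "k < n" "i = \<sigma> (Suc k)" using ex[OF i] by blast
    have "measure (cube {1..m}) (A i) = (1 - c (tt k)) * d (tt k)"
      unfolding A_def k(2) \<kappa>[OF k(1)]
    proof (rule measure_rectangle)
      show "v (pre k) \<in> {1..m}" "v k \<in> {1..m}"
        using nb vpre[OF k(1)] v(1)[OF k(1)] by blast+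
      show "v (pre k) \<noteq> v k" by (rule v_ne[OF k(1)])
      have "bb (tt k) \<le> 1"
        using b(2)[of "tt k - 1"] tt(1)[of k] by (auto simp: bb_def split: nat.split)
      then show "0 \<le> c (tt k)" "c (tt k) \<le> 1" "0 \<le> d (tt k)" "d (tt k) \<le> 1"
        using cd[OF tt(1), of k] b(1)[OF tt(1), of k] by linarith+
    qed
    then show ?thesis using cd[OF tt(1), of k] k by (simp add: tt(2)) (simp add: Q_def)
  qed
  ultimately have pos: "measure (cube {1..m}) (\<Inter>i\<in>{1..n}. space (cube {1..m}) - A i) > 0"
    by (rule int)
  have "(\<Inter>i\<in>{1..n}. space (cube {1..m}) - A i) = {}"
  proof (rule ccontr)
    assume "\<not> ?thesis"
    then obtain x where x: "\<And>i. i \<in> {1..n} \<Longrightarrow> x \<in> space (cube {1..m}) - A i" by blast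
    have xs: "x \<in> space (cube {1..m})" using x[of 1] n by auto
    have x01: "0 \<le> x j \<and> x j \<le> 1" if "j \<in> {1..m}" for j
      using xs that by (auto simp: cube_def space_PiM PiE_iff)
    have out: "c t \<le> x (v (pre ((r + t) mod n))) \<Longrightarrow> d t < x (v ((r + t) mod n))" if t: "t < n" for t
    proof -
      define k where "k = (r + t) mod n"
      have k: "k < n" using n by (simp add: k_def)
      have "tt k = t"
      proof -
        have "(k + n - r) mod n = t"
          using r t n by (cases "r + t < n") (auto simp: k_def mod_if)
        then show ?thesis by (simp add: tt_def)
      qed
      then show "c t \<le> x (v (pre ((r + t) mod n))) \<Longrightarrow> d t < x (v ((r + t) mod n))"
        using x[OF ran[OF k]] xs \<kappa>[OF k] by (auto simp: A_def k_def[symmetric])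
    qed
    have vm: "v k \<in> {1..m}" if "k < n" for k using v(1)[OF that] nb by blast
    \<comment> \<open>An uncovered point must exceed \<open>d t\<close> at each position in turn:
      since \<open>c (Suc t) \<le> b t \<le> d t\<close>, it can escape the next rectangle only
      through its upper side. At the end \<open>d (n - 1)\<close> is 1, beyond which there is no
      room.\<close>
    have "d t < x (v ((r + t) mod n))" if "t < n" for t
      using that
    proof (induction t)
      case 0
      have "c 0 \<le> 0" using cd[of 0] n by (simp add: bb_def)
      then have "c 0 \<le> x (v (pre ((r + 0) mod n)))" using x01[OF vm[OF pre(1)]] by (meson order_trans)
      then show ?case by (rule out[OF 0])
    next
      case (Suc t)
      have "c (Suc t) \<le> b t" "b t \<le> d t" using cd[of "Suc t"] cd[of t] Suc.prems by (auto simp: bb_def)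
      moreover have "pre ((r + Suc t) mod n) = (r + t) mod n"
        using pre_Suc[of "(r + t) mod n"] n by (simp add: mod_Suc_eq)
      ultimately have "c (Suc t) \<le> x (v (pre ((r + Suc t) mod n)))" using Suc by simp
      then show ?case by (rule out[OF Suc.prems])
    qed
    from this[of "n - 1"] have "d (n - 1) < x (v ((r + (n - 1)) mod n))" using n by simp
    moreover have "1 \<le> d (n - 1)" using cd[of "n - 1"] bn n by simp
    moreover have "x (v ((r + (n - 1)) mod n)) \<le> 1" using x01[OF vm] n by simp
    ultimately show False by linarith
  qed
  with pos show False by simp
qed

text \<open>Below the least scale all \<open>n\<close> paths are subcritical, as the lower bound
  requires; above it, the one path attaining the minimum already provides a cover.\<close>

theorem theorem4:
  fixes n m :: nat and E :: "(nat \<times> nat) set" and \<sigma> :: "nat \<Rightarrow> nat" and p :: "nat \<Rightarrow> real"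
  assumes "n \<ge> 3"
    and "bigraph n m E"
    and "n_cyclic n E"
    and "cycle_enumeration n E \<sigma>"
    and "\<forall>i\<in>{1..n}. 0 < p i \<and> p i < 1"
  shows "\<exists>lam :: nat \<Rightarrow> real.
           (\<forall>i\<in>{1..n}. is_min_scale n (\<lambda>k. p (\<sigma> k)) i (lam i)) \<and>
           (\<lambda>j. Min (lam ` {1..n}) * p j) \<in> lll_boundary n m E"
proof -
  note n = assms(1) and bi = assms(2) and cyc = assms(3) and ce = assms(4)
  have bij: "bij_betw \<sigma> {1..n} {1..n}" using ce by (simp add: cycle_enumeration_def)
  have ran: "\<sigma> (Suc k) \<in> {1..n}" if "k < n" for k
    by (rule bij_betw_apply[OF bij]) (use that in simp)
  define q where "q k = p (\<sigma> (Suc (k mod n)))" for k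
  have q: "0 < q k" for k using assms(5) ran[of "k mod n"] n by (auto simp: q_def)
  have "\<forall>r. \<exists>L>0. (\<forall>l. 0 < l \<and> l < L \<longrightarrow> subcritical n (\<lambda>k. l * q k) r) \<and>
    (\<forall>j<n - 1. chain (\<lambda>k. L * q k) r j < 1) \<and> chain (\<lambda>k. L * q k) r (n - 1) = 1"
    by (intro allI critical_scale) (use n q in auto)
  from choice[OF this] obtain L where L: "\<And>r. 0 < L r"
    "\<And>r l. 0 < l \<Longrightarrow> l < L r \<Longrightarrow> subcritical n (\<lambda>k. l * q k) r"
    "\<And>r j. j < n - 1 \<Longrightarrow> chain (\<lambda>k. L r * q k) r j < 1"
    "\<And>r. chain (\<lambda>k. L r * q k) r (n - 1) = 1"
    by blast
  define lam where "lam i = L (i - 1)" for i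
  have scale: "is_min_scale n (\<lambda>k. p (\<sigma> k)) i (lam i)" if i: "i \<in> {1..n}" for i
  proof -
    have "is_min_scale n (\<lambda>k. p (\<sigma> k)) (Suc (i - 1)) (L (i - 1))"
      by (rule is_min_scale_critical[OF n])
         (use i L q in \<open>auto simp: q_def\<close>)
    then show ?thesis using i by (simp add: lam_def)
  qed
  define l0 where "l0 = Min (lam ` {1..n})"
  have fin: "finite (lam ` {1..n})" "lam ` {1..n} \<noteq> {}" using n by auto
  have "l0 \<in> lam ` {1..n}" unfolding l0_def by (rule Min_in[OF fin])
  then obtain i where i: "i \<in> {1..n}" "l0 = lam i" by blast
  define r where "r = i - 1"
  have r: "r < n" "l0 = L r" using i by (auto simp: r_def lam_def)
  have l0L: "l0 \<le> L k" if "k < n" for k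
    unfolding l0_def using that by (intro Min_le fin image_eqI[of _ _ "Suc k"]) (auto simp: lam_def)
  have l0: "0 < l0" using L r by simp
  \<comment> \<open>The scaled probability is at most term \<open>0\<close> of the path starting at
    that event, taken at its own critical scale; there only the last term reaches 1.\<close>
  have small: "l0 * p i < 1" if "i \<in> {1..n}" for i
  proof -
    have "i \<in> \<sigma> ` {1..n}" using bij that by (simp add: bij_betw_def)
    then obtain k where k: "k \<in> {1..n}" "i = \<sigma> k" by blast
    then have "k - 1 < n" "p i = q (k - 1)" by (auto simp: q_def)
    then show ?thesis
      using L(3)[of 0 "k - 1"] n mult_right_mono[OF l0L[of "k - 1"] less_imp_le[OF q[of "k - 1"]]] by simp
  qed
  have "(\<lambda>j. l0 * p j) \<in> lll_boundary n m E"
    unfolding lll_boundary_def mem_Collect_eq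
  proof (intro conjI ballI)
    fix i assume i: "i \<in> {1..n}"
    show "0 < l0 * p i" using l0 assms(5) i by simp
    show "l0 * p i \<le> 1" using small[OF i] by simp
  next
    fix \<epsilon> :: real assume e: "\<epsilon> \<in> {0<..<1}"
    show "(\<lambda>i. (1 - \<epsilon>) * (l0 * p i)) \<in> lll_interior n m E"
    proof (rule subcritical_in_interior[OF n bi cyc ce])
      fix i assume i: "i \<in> {1..n}"
      have "(1 - \<epsilon>) * (l0 * p i) < 1 * (l0 * p i)"
        using e l0 assms(5) i by (intro mult_strict_right_mono) auto
      then have "(1 - \<epsilon>) * (l0 * p i) < 1" using small[OF i] by linarith
      then show "0 < (1 - \<epsilon>) * (l0 * p i) \<and> (1 - \<epsilon>) * (l0 * p i) < 1"
        using e l0 assms(5) i by auto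
    next
      fix k
      let ?Q = "\<lambda>k. ((1 - \<epsilon>) * l0) * q k"
      have "subcritical n ?Q (k + n) = subcritical n ?Q k" for k
        using subcritical_shift[of n ?Q n k] by (simp add: q_def)
      from periodic_mod[of "subcritical n ?Q" n, OF this]
      have "subcritical n ?Q k = subcritical n ?Q (k mod n)" .
      moreover have "(1 - \<epsilon>) * l0 < L (k mod n)"
      proof -
        have "(1 - \<epsilon>) * l0 < 1 * l0" using e l0 by (intro mult_strict_right_mono) auto
        moreover have "l0 \<le> L (k mod n)" using l0L[of "k mod n"] n by simp
        ultimately show ?thesis by linarith
      qed
      then have "subcritical n ?Q (k mod n)" using e l0 by (intro L(2)) auto
      ultimately show "subcritical n (\<lambda>k. (1 - \<epsilon>) * (l0 * p (\<sigma> (Suc (k mod n))))) k"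
        by (simp add: q_def[abs_def] mult.assoc)
    qed
    show "(\<lambda>i. (1 + \<epsilon>) * (l0 * p i)) \<notin> lll_interior n m E"
    proof (rule critical_not_in_interior[OF n bi cyc ce r(1), where p = "\<lambda>i. l0 * p i"])
      show "0 < l0 * p i \<and> l0 * p i \<le> (1 + \<epsilon>) * (l0 * p i)" if "i \<in> {1..n}" for i
      proof -
        have "0 < l0 * p i" using l0 assms(5) that by simp
        moreover from this have "0 < \<epsilon> * (l0 * p i)" using e by simp
        ultimately show ?thesis by (simp add: distrib_right)
      qed
      show "chain (\<lambda>k. l0 * p (\<sigma> (Suc (k mod n)))) r j < 1" if "j < n - 1" for j
        using L(3)[OF that, of r] r by (simp add: q_def)
      show "chain (\<lambda>k. l0 * p (\<sigma> (Suc (k mod n)))) r (n - 1) = 1"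
        using L(4)[of r] r by (simp add: q_def)
    qed
  qed
  then show ?thesis using scale by (intro exI[of _ lam]) (simp add: l0_def)
qed

end
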